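(* Let $p$ be a prime, $q$ a power of $p$, $n\ge1$, let $\overline{T}$ be a maximal $\sigma$-invariant torus of $\overline{G}=\mathrm{Sp}_{2n}(\overline{\mathbb F}_p)$, and let $T=\overline{T}\cap G$ be the corresponding maximal torus of $G=\mathrm{Sp}_{2n}(q)$, of type $(\overline{n_1})\ldots(\overline{n_k})(n_{k+1})\ldots(n_m)$. Let $N=N_{\overline{G}}(\overline{T})\cap G$. Then $T$ has a complement in $N$ if and only if $p=2$.
   Context: Rows and columns of $2n\times 2n$ matrices are indexed in the order $1,\dots,n,-1,\dots,-n$. $\mathrm{Sp}_{2n}(\overline{\mathbb F}_p)=\{A\in \mathrm{GL}_{2n}(\overline{\mathbb F}_p): A^{tr}QA=Q\}$ with $Q=\begin{pmatrix}0&I_n\\-I_n&0\end{pmatrix}$. $\sigma$ is the endomorphism $(a_{ij})\mapsto(a_{ij}^q)$, and $\mathrm{Sp}_{2n}(q)$ is the group of its fixed points in $\mathrm{Sp}_{2n}(\overline{\mathbb F}_p)$. Type of a torus. Let $\overline{T}_0$ be the group of all matrices $\mathrm{diag}(D,D^{-1})$ in $\overline{G}$, $D$ an invertible diagonal $n\times n$ matrix. Let $W=N_{\overline{G}}(\overline{T}_0)/\overline{T}_0$ with natural map $\pi:N_{\overline{G}}(\overline{T}_0)\to W$. Elements of $N_{\overline{G}}(\overline{T}_0)$ are monomial matrices, and via the induced permutations of the indices $W$ is identified with the group $\mathrm{Sl}_n$ of permutations $\varphi$ of $\{1,\dots,n,-1,\dots,-n\}$ with $\varphi(-i)=-\varphi(i)$;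 $\sigma$ acts trivially on $W$. Forgetting signs gives a homomorphism $\mathrm{Sl}_n\to\mathrm{Sym}_n$. If $\varphi\in\mathrm{Sl}_n$ maps to a cycle $(i_1 i_2\ldots i_l)$ and fixes all elements other than $\pm i_1,\dots,\pm i_l$, then, choosing signs of the $i_j$ so that $\varphi(i_j)=i_{j+1}$ for $j<l$, it is called a positive cycle of length $l$ if $\varphi(i_l)=i_1$ and a negative cycle of length $l$ if $\varphi(i_l)=-i_1$ (length 1 included: $\pm i$ fixed, resp. interchanged). Each $\varphi\in \mathrm{Sl}_n$ is uniquely a product of independent positive and negative cycles; $\varphi$ has cyclic type $(\overline{n_1})\ldots(\overline{n_k})(n_{k+1})\ldots(n_m)$, where $0\le k\le m$, $n_i\geq 1$ and $n_1+\dots+n_m=n$, if its negative cycles have lengths $n_1,\dots,n_k$ and its positive cycles have lengths $n_{k+1},\dots,n_m$. Every $\sigma$-invariant maximal torus is $\overline{T}=\overline{T}_0^{\,g}=g^{-1}\overline{T}_0g$ for some $g\in\overline{G}$ with $g^\sigma g^{-1}\in N_{\overline{G}}(\overline{T}_0)$; the corresponding torus $T=\overline{T}\cap G$ is said to have type $(\overline{n_1})\ldots(\overline{n_k})(n_{k+1})\ldots(n_m)$ if $\pi(g^\sigma g^{-1})$ has this cyclic type. For subgroups $T\trianglelefteq N$, "$T$ has a complement in $N$" means that there is a subgroup $H$ with $N=T\rtimes H$. *)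

theory Defs
  imports
    "HOL-Algebra.Algebraic_Closure_Type"
    "HOL-Algebra.Group_Action"
    "HOL-Combinatorics.Permutations"
    "Jordan_Normal_Form.Determinant"
    "Berlekamp_Zassenhaus.Finite_Field"
begin

text \<open>
  For \<^typ>\<open>'p::prime_card\<close> the type \<^typ>\<open>'p mod_ring\<close> is the prime field with
  \<open>p = CARD('p)\<close> elements, and \<^typ>\<open>'p mod_ring alg_closure\<close> is its algebraic closure.
\<close>

section \<open>Linear algebraic groups and tori\<close>

definition GL :: "nat \<Rightarrow> 'a::field mat monoid" where
  "GL m = units_of (ring_mat TYPE('a) m ())"

text \<open>The coordinate ring of $GL_m$: polynomials in the matrix entries and $1/\det$.\<close>

inductive_set regular_functions :: "nat \<Rightarrow> ('a::field mat \<Rightarrow> 'a) set" for m :: nat where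
  const: "(\<lambda>A. c) \<in> regular_functions m"
| entry: "i < m \<Longrightarrow> j < m \<Longrightarrow> (\<lambda>A. A $$ (i, j)) \<in> regular_functions m"
| inverse_det: "(\<lambda>A. inverse (det A)) \<in> regular_functions m"
| add: "f \<in> regular_functions m \<Longrightarrow> g \<in> regular_functions m \<Longrightarrow>
    (\<lambda>A. f A + g A) \<in> regular_functions m"
| mult: "f \<in> regular_functions m \<Longrightarrow> g \<in> regular_functions m \<Longrightarrow>
    (\<lambda>A. f A * g A) \<in> regular_functions m"

definition zariski_closed :: "nat \<Rightarrow> 'a::field mat set \<Rightarrow> bool" where
  "zariski_closed m S \<longleftrightarrow>
    (\<exists>F \<subseteq> regular_functions m. S = {A \<in> carrier (GL m). \<forall>f\<in>F. f A = 0})"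

definition linear_algebraic_group :: "nat \<Rightarrow> 'a::field mat set \<Rightarrow> bool" where
  "linear_algebraic_group m S \<longleftrightarrow> subgroup S (GL m) \<and> zariski_closed m S"

definition regular_map :: "nat \<Rightarrow> 'a::field mat set \<Rightarrow> nat \<Rightarrow> ('a mat \<Rightarrow> 'a mat) \<Rightarrow> bool" where
  "regular_map m S l f \<longleftrightarrow>
    (\<forall>i<l. \<forall>j<l. \<exists>h \<in> regular_functions m. \<forall>A\<in>S. f A $$ (i, j) = h A)"

definition algebraic_group_isomorphic ::
    "nat \<Rightarrow> 'a::field mat set \<Rightarrow> nat \<Rightarrow> 'a mat set \<Rightarrow> bool" where
  "algebraic_group_isomorphic m S l S' \<longleftrightarrow>
    (\<exists>f \<in> iso ((GL m)\<lparr>carrier := S\<rparr>) ((GL l)\<lparr>carrier := S'\<rparr>).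
       regular_map m S l f \<and> regular_map l S' m (inv_into S f))"

definition diagonal_group :: "nat \<Rightarrow> 'a::field mat set" where
  "diagonal_group r = {D \<in> carrier (GL r). diagonal_mat D}"

definition torus :: "nat \<Rightarrow> 'a::field mat set \<Rightarrow> bool" where
  "torus m S \<longleftrightarrow> linear_algebraic_group m S \<and>
    (\<exists>r. algebraic_group_isomorphic m S r (diagonal_group r))"

section \<open>The symplectic group\<close>

text \<open>
  Row and column positions \<open>0, \<dots>, n - 1, n, \<dots>, 2n - 1\<close> of a matrix carry the labels
  \<open>1, \<dots>, n, -1, \<dots>, -n\<close>; see \<open>index_label\<close> below.
\<close>

definition symplectic_form :: "nat \<Rightarrow> 'a::field mat" where
  "symplectic_form n = four_block_mat (0\<^sub>m n n) (1\<^sub>m n) (- 1\<^sub>m n) (0\<^sub>m n n)"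

definition Sp :: "nat \<Rightarrow> 'a::field mat monoid" where
  "Sp n = (GL (2 * n))\<lparr>carrier := {A \<in> carrier (GL (2 * n)).
     transpose_mat A * symplectic_form n * A = symplectic_form n}\<rparr>"

definition frobenius :: "nat \<Rightarrow> 'a::field mat \<Rightarrow> 'a mat" where
  "frobenius q = map_mat (\<lambda>x. x ^ q)"

definition Sp_fixed :: "nat \<Rightarrow> nat \<Rightarrow> 'a::field mat set" where
  "Sp_fixed n q = {A \<in> carrier (Sp n). frobenius q A = A}"

definition maximal_torus :: "nat \<Rightarrow> 'a::field mat set \<Rightarrow> bool" where
  "maximal_torus n S \<longleftrightarrow> torus (2 * n) S \<and> S \<subseteq> carrier (Sp n) \<and>
    (\<forall>S'. torus (2 * n) S' \<and> S' \<subseteq> carrier (Sp n) \<and> S \<subseteq> S' \<longrightarrow> S' = S)"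

section \<open>Signed permutations and the type of a torus\<close>

definition signed_points :: "nat \<Rightarrow> int set" where
  "signed_points n = {1..int n} \<union> uminus ` {1..int n}"

definition Sl :: "nat \<Rightarrow> (int \<Rightarrow> int) set" where
  "Sl n = {\<phi>. \<phi> permutes signed_points n \<and> (\<forall>i \<in> signed_points n. \<phi> (- i) = - \<phi> i)}"

text \<open>
  The list \<open>xs\<close> of signed representatives $i_1, \dots, i_l$ belongs to the data, since a positive
  cycle of length 1 is the identity permutation and does not determine its support.
\<close>

definition signed_cycle :: "nat \<Rightarrow> bool \<Rightarrow> (int \<Rightarrow> int) \<Rightarrow> int list \<Rightarrow> bool" where
  "signed_cycle n negative \<phi> xs \<longleftrightarrow>
    \<phi> \<in> Sl n \<and> xs \<noteq> [] \<and> set xs \<subseteq> signed_points n \<and> distinct (map abs xs) \<and>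
    (\<forall>j. Suc j < length xs \<longrightarrow> \<phi> (xs ! j) = xs ! Suc j) \<and>
    \<phi> (last xs) = (if negative then - hd xs else hd xs) \<and>
    (\<forall>i. \<bar>i\<bar> \<notin> abs ` set xs \<longrightarrow> \<phi> i = i)"

text \<open>
  The type $(\overline{n_1})\ldots(\overline{n_k})(n_{k+1})\ldots(n_m)$ is given by \<open>k\<close> and
  \<open>ns = [n_1, \<dots>, n_m]\<close>.
\<close>

definition has_cyclic_type :: "nat \<Rightarrow> (int \<Rightarrow> int) \<Rightarrow> nat \<Rightarrow> nat list \<Rightarrow> bool" where
  "has_cyclic_type n \<phi> k ns \<longleftrightarrow>
    k \<le> length ns \<and> (\<forall>l \<in> set ns. 1 \<le> l) \<and> sum_list ns = n \<and>
    (\<exists>\<psi>s xss. length \<psi>s = length ns \<and> map length xss = ns \<and>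
       (\<forall>i < length ns. signed_cycle n (i < k) (\<psi>s ! i) (xss ! i)) \<and>
       distinct (map abs (concat xss)) \<and>
       \<phi> = foldr (\<circ>) \<psi>s id)"

definition T0 :: "nat \<Rightarrow> 'a::field mat set" where
  "T0 n = {A \<in> carrier (Sp n). \<exists>D D'. D \<in> carrier (GL n) \<and> diagonal_mat D \<and>
     D' = inv\<^bsub>GL n\<^esub> D \<and> A = four_block_mat D (0\<^sub>m n n) (0\<^sub>m n n) D'}"

definition index_label :: "nat \<Rightarrow> nat \<Rightarrow> int" where
  "index_label n i = (if i < n then int i + 1 else - (int i - int n + 1))"

text \<open>
  A monomial matrix sends the label of a row to the label of the column of its nonzero entry.
  The opposite convention replaces \<open>\<phi>\<close> by its inverse, which has the same cyclic type.
\<close>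

definition induces_permutation :: "nat \<Rightarrow> 'a::field mat \<Rightarrow> (int \<Rightarrow> int) \<Rightarrow> bool" where
  "induces_permutation n A \<phi> \<longleftrightarrow>
    \<phi> permutes signed_points n \<and>
    (\<forall>i < 2 * n. \<forall>j < 2 * n. A $$ (i, j) \<noteq> 0 \<longleftrightarrow> \<phi> (index_label n i) = index_label n j)"

definition torus_has_type :: "nat \<Rightarrow> nat \<Rightarrow> 'a::field mat set \<Rightarrow> nat \<Rightarrow> nat list \<Rightarrow> bool" where
  "torus_has_type n q S k ns \<longleftrightarrow>
    (\<exists>g \<in> carrier (Sp n).
       S = inv\<^bsub>Sp n\<^esub> g <#\<^bsub>Sp n\<^esub> T0 n #>\<^bsub>Sp n\<^esub> g \<and>
       frobenius q g \<otimes>\<^bsub>Sp n\<^esub> inv\<^bsub>Sp n\<^esub> g \<in> normalizer (Sp n) (T0 n) \<and>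
       (\<exists>\<phi> \<in> Sl n. induces_permutation n (frobenius q g \<otimes>\<^bsub>Sp n\<^esub> inv\<^bsub>Sp n\<^esub> g) \<phi> \<and>
          has_cyclic_type n \<phi> k ns))"

section \<open>Complements\<close>

definition has_complement :: "('a, 'b) monoid_scheme \<Rightarrow> 'a set \<Rightarrow> 'a set \<Rightarrow> bool" where
  "has_complement G T N \<longleftrightarrow>
    T \<lhd> (G\<lparr>carrier := N\<rparr>) \<and>
    (\<exists>H. subgroup H (G\<lparr>carrier := N\<rparr>) \<and> T <#>\<^bsub>G\<^esub> H = N \<and> T \<inter> H = {\<one>\<^bsub>G\<^esub>})"

end

theory Submission
  imports Defs "HOL-Combinatorics.Cycles"
begin

text \<open>
  Write \<open>Tbar = g\<inverse> T0 g\<close> and \<open>h = \<sigma>(g) g\<inverse>\<close>, an element of the normalizer of \<open>T0\<close>. Conjugation by \<open>g\<close>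
  identifies \<open>T\<close> and \<open>N\<close> with the elements \<open>x\<close> of \<open>T0\<close> and of its normalizer which satisfy
  \<open>\<sigma>(x) = h x h\<inverse>\<close> (lemma \<open>conj_by_fixed_iff\<close>). What makes this twisted condition tractable is Lang's
  theorem for \<open>T0\<close>: for \<open>m\<close> normalizing \<open>T0\<close> and \<open>c\<close> in \<open>T0\<close>, the equation \<open>\<sigma>(s) c = m s m\<inverse>\<close> has a
  solution \<open>s\<close> in \<open>T0\<close> (\<open>T0_lang\<close>). It is proved by hand: \<open>m\<close> is a monomial matrix
  (\<open>normalizer_T0_monomial\<close>), so it permutes the diagonal entries, and the resulting system of
  equations is solved by a telescoping product (\<open>lang_weights\<close>).

  For odd \<open>p\<close> the symplectic form \<open>Q\<close>, which is itself a symplectic matrix, inverts every element of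
  \<open>T0\<close> and represents the central element \<open>-1\<close> of the Weyl group. Every element of the coset \<open>T0 Q\<close>
  squares to \<open>Q\<^sup>2 = -1\<close>, which is not the identity. By Lang's theorem the coset meets the group
  corresponding to \<open>N\<close>, for every type of torus. A complement would contain an element of this coset
  whose square lies both in the complement and in \<open>T\<close> without being trivial (\<open>no_complement\<close>).

  For \<open>p = 2\<close> there are no signs: the permutation matrices in the normalizer of \<open>T0\<close> form a complement
  to \<open>T0\<close> (\<open>normalizer_decomp_char_2\<close>), and the Frobenius map fixes them. By Lang's theorem \<open>g\<close> can be
  changed so that \<open>h\<close> becomes a permutation matrix \<open>u\<close>. The permutation matrices commuting with \<open>u\<close>
  then give a complement to \<open>T\<close> in \<open>N\<close> (\<open>complement\<close>).
\<close>

section \<open>Normalizers and conjugation\<close>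

context group begin

lemma mult_inv_cancel_left [simp]:
  assumes "x \<in> carrier G" "y \<in> carrier G"
  shows "x \<otimes> (inv x \<otimes> y) = y" "inv x \<otimes> (x \<otimes> y) = y"
  using assms by (simp_all flip: m_assoc)

lemma subgroup_normalizer:
  assumes "S \<subseteq> carrier G"
  shows "subgroup (normalizer G S) G"
  unfolding normalizer_def
  by (rule group_action.stabilizer_subgroup[OF action_by_conjugation_on_power_set]) (use assms in auto)

lemma mem_normalizer_iff:
  assumes "S \<subseteq> carrier G"
  shows "x \<in> normalizer G S \<longleftrightarrow> x \<in> carrier G \<and> (\<lambda>s. x \<otimes> s \<otimes> inv x) ` S = S"
proof -
  have "x <# S #> inv x = (\<lambda>s. x \<otimes> s \<otimes> inv x) ` S"
    by (auto simp: l_coset_def r_coset_def)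
  then show ?thesis
    using assms by (auto simp: normalizer_def stabilizer_def)
qed

lemma normalizer_conjugate_mem:
  assumes "S \<subseteq> carrier G" "x \<in> normalizer G S" "s \<in> S"
  shows "x \<otimes> s \<otimes> inv x \<in> S"
  using assms mem_normalizer_iff by blast

text \<open>The inclusion for \<open>inv x\<close> is the reverse inclusion for \<open>x\<close>.\<close>

lemma normalizerI:
  assumes "S \<subseteq> carrier G" "x \<in> carrier G"
    and "\<And>s. s \<in> S \<Longrightarrow> x \<otimes> s \<otimes> inv x \<in> S"
    and "\<And>s. s \<in> S \<Longrightarrow> inv x \<otimes> s \<otimes> x \<in> S"
  shows "x \<in> normalizer G S"
proof -
  have "s \<in> (\<lambda>s. x \<otimes> s \<otimes> inv x) ` S" if "s \<in> S" for s
  proof (rule image_eqI)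
    show "s = x \<otimes> (inv x \<otimes> s \<otimes> x) \<otimes> inv x"
      using assms that by (simp add: m_assoc subsetD)
  qed (use assms that in auto)
  then show ?thesis
    using assms by (auto simp: mem_normalizer_iff)
qed

definition conj_by :: "'a \<Rightarrow> 'a \<Rightarrow> 'a" where
  "conj_by g x = inv g \<otimes> x \<otimes> g"

lemma conj_by_closed [simp]:
  "g \<in> carrier G \<Longrightarrow> x \<in> carrier G \<Longrightarrow> conj_by g x \<in> carrier G"
  by (simp add: conj_by_def)

lemma conj_by_mult:
  assumes "g \<in> carrier G" "x \<in> carrier G" "y \<in> carrier G"
  shows "conj_by g (x \<otimes> y) = conj_by g x \<otimes> conj_by g y"
  using assms by (simp add: conj_by_def m_assoc)

lemma conj_by_conj_by:
  assumes "g \<in> carrier G" "h \<in> carrier G" "x \<in> carrier G"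
  shows "conj_by g (conj_by h x) = conj_by (h \<otimes> g) x"
  using assms by (simp add: conj_by_def m_assoc inv_mult_group)

lemma conj_by_one [simp]: "x \<in> carrier G \<Longrightarrow> conj_by \<one> x = x"
  by (simp add: conj_by_def)

lemma conj_by_one_right [simp]: "g \<in> carrier G \<Longrightarrow> conj_by g \<one> = \<one>"
  by (simp add: conj_by_def)

lemma conj_by_inv:
  assumes "g \<in> carrier G" "x \<in> carrier G"
  shows "inv (conj_by g x) = conj_by g (inv x)"
  using assms by (simp add: conj_by_def m_assoc inv_mult_group)

lemma conj_by_inverse [simp]:
  assumes "g \<in> carrier G" "x \<in> carrier G"
  shows "conj_by g (conj_by (inv g) x) = x" "conj_by (inv g) (conj_by g x) = x"
  using assms by (simp_all add: conj_by_conj_by)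

lemma conj_by_eq_iff [simp]:
  assumes "g \<in> carrier G" "x \<in> carrier G" "y \<in> carrier G"
  shows "conj_by g x = conj_by g y \<longleftrightarrow> x = y"
  by (metis assms conj_by_inverse(2))

lemma conj_by_image_eq_coset: "inv g <# S #> g = conj_by g ` S"
  by (auto simp: l_coset_def r_coset_def conj_by_def)

lemma conj_by_subgroup:
  assumes "g \<in> carrier G" "subgroup S G"
  shows "subgroup (conj_by g ` S) G"
proof -
  interpret S: subgroup S G by fact
  show ?thesis
  proof (rule subgroupI)
    show "a \<otimes> b \<in> conj_by g ` S" if "a \<in> conj_by g ` S" "b \<in> conj_by g ` S" for a b
      using that assms by (auto simp flip: conj_by_mult)
    show "conj_by g ` S \<noteq> {}" using S.one_closed by blast
  qed (use assms conj_by_inv in auto)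
qed

lemma normalizer_conj_by:
  assumes g: "g \<in> carrier G" and S: "S \<subseteq> carrier G"
  shows "normalizer G (conj_by g ` S) = conj_by g ` normalizer G S"
proof -
  have *: "conj_by g ` normalizer G S \<subseteq> normalizer G (conj_by g ` S)"
    if "g \<in> carrier G" "S \<subseteq> carrier G" for g S
  proof (clarify, rule normalizerI)
    fix x assume x: "x \<in> normalizer G S"
    have N: "subgroup (normalizer G S) G" by (rule subgroup_normalizer[OF that(2)])
    have xc: "x \<in> carrier G" using x N subgroup.mem_carrier by metis
    have xi: "inv x \<in> normalizer G S" using x N subgroup.m_inv_closed by metis
    show "conj_by g ` S \<subseteq> carrier G" using that by auto
    show "conj_by g x \<in> carrier G" using that xc by simp
    fix s assume "s \<in> conj_by g ` S"
    then obtain t where t: "t \<in> S" "s = conj_by g t" by auto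
    have tc: "t \<in> carrier G" using t that by auto
    have "conj_by g (x \<otimes> t \<otimes> inv x) \<in> conj_by g ` S"
      by (rule imageI) (rule normalizer_conjugate_mem[OF that(2) x t(1)])
    then show "conj_by g x \<otimes> s \<otimes> inv conj_by g x \<in> conj_by g ` S"
      using that xc tc by (simp add: t conj_by_mult conj_by_inv)
    have "conj_by g (inv x \<otimes> t \<otimes> inv (inv x)) \<in> conj_by g ` S"
      by (rule imageI) (rule normalizer_conjugate_mem[OF that(2) xi t(1)])
    then show "inv conj_by g x \<otimes> s \<otimes> conj_by g x \<in> conj_by g ` S"
      using that xc tc by (simp add: t conj_by_mult conj_by_inv)
  qed
  have "conj_by (inv g) ` normalizer G (conj_by g ` S)
      \<subseteq> normalizer G (conj_by (inv g) ` conj_by g ` S)"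
    by (rule *) (use g S in auto)
  also have "conj_by (inv g) ` conj_by g ` S = S"
    using g S by (force simp: image_image)
  finally have "conj_by g ` conj_by (inv g) ` normalizer G (conj_by g ` S)
      \<subseteq> conj_by g ` normalizer G S" by blast
  moreover have "conj_by g ` conj_by (inv g) ` normalizer G (conj_by g ` S)
      = normalizer G (conj_by g ` S)"
  proof -
    have "normalizer G (conj_by g ` S) \<subseteq> carrier G"
    proof (rule subgroup.subset[OF subgroup_normalizer])
      show "conj_by g ` S \<subseteq> carrier G" using g S by auto
    qed
    then show ?thesis using g by (force simp: image_image)
  qed
  ultimately show ?thesis using *[OF g S] by blast
qed

end

section \<open>Complements in groups with a Lang-type endomorphism\<close>

text \<open>
  The algebraic groups enter the splitting question only through the solvability of
  \<open>\<sigma>(s) c = m s m\<inverse>\<close> in the torus \<open>S\<close>, for \<open>m\<close> normalizing \<open>S\<close>. This is the form which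
  Lang's theorem takes for a torus and its endomorphism \<open>s \<mapsto> m\<inverse> \<sigma>(s) m\<close>.
\<close>

locale lang_torus = group G for G (structure) +
  fixes \<sigma> :: "'a \<Rightarrow> 'a" and S :: "'a set"
  assumes \<sigma>_hom: "\<sigma> \<in> hom G G"
    and S_subgroup: "subgroup S G"
    and S_comm: "s \<in> S \<Longrightarrow> t \<in> S \<Longrightarrow> s \<otimes> t = t \<otimes> s"
    and lang: "m \<in> normalizer G S \<Longrightarrow> c \<in> S \<Longrightarrow> \<exists>s\<in>S. \<sigma> s \<otimes> c = m \<otimes> s \<otimes> inv m"
begin

definition fixed :: "'a set" where
  "fixed = {x \<in> carrier G. \<sigma> x = x}"

sublocale \<sigma>: group_hom G G \<sigma>
  using \<sigma>_hom by unfold_locales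

lemma fixed_subgroup: "subgroup fixed G"
  by (rule subgroupI) (auto simp: fixed_def)

lemma S_carrier: "s \<in> S \<Longrightarrow> s \<in> carrier G"
  using S_subgroup by (rule subgroup.mem_carrier)

lemma S_subset: "S \<subseteq> carrier G"
  using S_carrier by blast

lemma normalizer_carrier: "m \<in> normalizer G S \<Longrightarrow> m \<in> carrier G"
  using S_subset by (simp add: mem_normalizer_iff)

lemma S_normalizer: "s \<in> S \<Longrightarrow> s \<in> normalizer G S"
  using S_subset S_subgroup
  by (intro normalizerI) (auto simp: subgroup.m_closed subgroup.m_inv_closed)

text \<open>
  Lang's correspondence between \<open>\<sigma>\<close>-invariant conjugates of \<open>S\<close> and twists: conjugation by \<open>g\<close>
  turns fixed points of \<open>\<sigma>\<close> into fixed points of \<open>\<sigma>\<close> twisted by \<open>h = \<sigma>(g) g\<inverse>\<close>. All computations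
  about the conjugated torus can therefore be done inside the normalizer of \<open>S\<close>.
\<close>

lemma conj_by_fixed_iff:
  assumes "g \<in> carrier G" "h \<in> carrier G" "\<sigma> g = h \<otimes> g" "x \<in> carrier G"
  shows "conj_by g x \<in> fixed \<longleftrightarrow> \<sigma> x = h \<otimes> x \<otimes> inv h"
proof -
  have "\<sigma> (conj_by g x) = conj_by (h \<otimes> g) (\<sigma> x)"
    using assms by (simp add: conj_by_def)
  also have "\<dots> = conj_by g (conj_by h (\<sigma> x))"
    using assms by (simp add: conj_by_conj_by)
  finally have "conj_by g x \<in> fixed \<longleftrightarrow> conj_by h (\<sigma> x) = x"
    using assms by (simp add: fixed_def)
  also have "\<dots> \<longleftrightarrow> conj_by (inv h) (conj_by h (\<sigma> x)) = conj_by (inv h) x"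
    using assms by (intro conj_by_eq_iff[symmetric]) auto
  also have "\<dots> \<longleftrightarrow> \<sigma> x = h \<otimes> x \<otimes> inv h"
    using assms by (simp add: conj_by_def[of "inv h" x])
  finally show ?thesis .
qed

text \<open>
  Since \<open>w\<close> inverts \<open>S\<close>, every element of the coset \<open>S w\<close> has the same square \<open>w w\<close>, an element
  of \<open>S\<close>. The Lang equation shows that the coset of \<open>w\<close> has a representative fixed by the twisted
  endomorphism. A complement would contain such a representative, and its square would be a
  nontrivial element of both the complement and the torus.

  The two defects \<open>w w\<close> and \<open>h w h\<inverse> w\<inverse>\<close> lie in \<open>S\<close> because they centralize it: inversion
  is an involution and commutes with every automorphism of \<open>S\<close>.
\<close>

lemma no_complement:
  assumes g: "g \<in> carrier G" and h: "h \<in> normalizer G S" "\<sigma> g = h \<otimes> g"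
    and w: "w \<in> carrier G" "\<sigma> w = w" "w \<otimes> w \<noteq> \<one>"
    and inverts: "\<And>s. s \<in> S \<Longrightarrow> w \<otimes> s = inv s \<otimes> w"
    and centralizer: "\<And>x. x \<in> carrier G \<Longrightarrow> (\<And>s. s \<in> S \<Longrightarrow> x \<otimes> s = s \<otimes> x) \<Longrightarrow> x \<in> S"
  shows "\<not> has_complement G (conj_by g ` S \<inter> fixed) (normalizer G (conj_by g ` S) \<inter> fixed)"
proof
  let ?T = "conj_by g ` S \<inter> fixed"
  let ?N = "normalizer G (conj_by g ` S) \<inter> fixed"
  interpret S: subgroup S G by (rule S_subgroup)
  assume "has_complement G ?T ?N"
  then obtain H where H: "subgroup H (G\<lparr>carrier := ?N\<rparr>)" "?T <#> H = ?N" "?T \<inter> H = {\<one>}"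
    by (auto simp: has_complement_def)
  have c: "h \<in> carrier G" "w \<in> carrier G"
    using h w normalizer_carrier by auto
  have inverts': "inv w \<otimes> s = inv s \<otimes> inv w" if "s \<in> S" for s
  proof -
    have "inv w \<otimes> s = inv w \<otimes> (s \<otimes> w) \<otimes> inv w"
      using that c by (simp add: m_assoc)
    also have "s \<otimes> w = w \<otimes> inv s"
      using inverts[of "inv s"] that by simp
    finally show ?thesis using that c by simp
  qed
  have wN: "w \<in> normalizer G S"
    using S_subset c by (intro normalizerI) (simp_all add: inverts inverts' m_assoc)
  have ww: "w \<otimes> w \<in> S"
  proof (rule centralizer)
    fix s assume s: "s \<in> S"
    have "w \<otimes> w \<otimes> s = w \<otimes> (inv s \<otimes> w)"
      using s c by (simp add: m_assoc inverts)
    also have "\<dots> = s \<otimes> (w \<otimes> w)"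
      using s c inverts[of "inv s"] by (simp flip: m_assoc)
    finally show "w \<otimes> w \<otimes> s = s \<otimes> (w \<otimes> w)" .
  qed (use c in simp)
  define k where "k = h \<otimes> w \<otimes> inv h \<otimes> inv w"
  have k: "k \<in> S"
  proof (rule centralizer)
    fix s assume s: "s \<in> S"
    have "inv h \<in> normalizer G S"
      using h(1) subgroup_normalizer[OF S_subset] subgroup.m_inv_closed by metis
    then have r: "inv h \<otimes> s \<otimes> h \<in> S"
      using normalizer_conjugate_mem[OF S_subset _ s, of "inv h"] c by simp
    have "k \<otimes> s = h \<otimes> w \<otimes> (inv h \<otimes> inv s \<otimes> h) \<otimes> inv h \<otimes> inv w"
      using s c by (simp add: k_def m_assoc inverts')
    also have "\<dots> = h \<otimes> (w \<otimes> inv (inv h \<otimes> s \<otimes> h)) \<otimes> inv h \<otimes> inv w"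
      using s c by (simp add: inv_mult_group m_assoc)
    also have "w \<otimes> inv (inv h \<otimes> s \<otimes> h) = (inv h \<otimes> s \<otimes> h) \<otimes> w"
      using inverts[OF S.m_inv_closed[OF r]] r by simp
    also have "h \<otimes> (inv h \<otimes> s \<otimes> h \<otimes> w) \<otimes> inv h \<otimes> inv w = s \<otimes> k"
      using s c by (simp add: k_def m_assoc)
    finally show "k \<otimes> s = s \<otimes> k" .
  qed (use c in \<open>simp add: k_def\<close>)
  obtain s where s: "s \<in> S" "\<sigma> s \<otimes> inv k = h \<otimes> s \<otimes> inv h"
    using lang[OF h(1) S.m_inv_closed[OF k]] by blast
  have kw: "k \<otimes> w = h \<otimes> w \<otimes> inv h"
    using c by (simp add: k_def m_assoc)
  have "\<sigma> s = \<sigma> s \<otimes> inv k \<otimes> k"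
    using s(1) k by (simp add: m_assoc)
  also have "\<dots> = h \<otimes> s \<otimes> inv h \<otimes> k" by (simp only: s(2))
  finally have "\<sigma> s = h \<otimes> s \<otimes> inv h \<otimes> k" .
  then have "\<sigma> (s \<otimes> w) = h \<otimes> s \<otimes> inv h \<otimes> (k \<otimes> w)"
    using s k c w by (simp add: m_assoc)
  also have "\<dots> = h \<otimes> (s \<otimes> w) \<otimes> inv h"
    using s c by (simp add: kw m_assoc)
  finally have "conj_by g (s \<otimes> w) \<in> fixed"
    using conj_by_fixed_iff[OF g c(1) h(2)] s c by simp
  moreover have "s \<otimes> w \<in> normalizer G S"
    using S_normalizer[OF s(1)] wN subgroup_normalizer[OF S_subset] subgroup.m_closed by metis
  ultimately have "conj_by g (s \<otimes> w) \<in> ?N"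
    using g S_subset by (simp add: normalizer_conj_by)
  then obtain t y where ty: "t \<in> S" "y \<in> H" "conj_by g (s \<otimes> w) = conj_by g t \<otimes> y"
    unfolding H(2)[symmetric] set_mult_def by auto
  have yN: "y \<in> ?N" using H(1) ty subgroup.mem_carrier by force
  then have yc: "y \<in> carrier G" by (simp add: fixed_def)
  \<comment> \<open>The component of the fixed representative in the complement still lies over \<open>S w\<close>.\<close>
  define r where "r = inv t \<otimes> s"
  have r: "r \<in> S" using s ty r_def by simp
  have "y = inv (conj_by g t) \<otimes> conj_by g (s \<otimes> w)"
    using ty(1) yc g by (simp add: ty(3))
  also have "\<dots> = conj_by g (r \<otimes> w)"
    using ty(1) s(1) g c by (simp add: conj_by_inv r_def m_assoc flip: conj_by_mult)
  finally have y: "y = conj_by g (r \<otimes> w)" .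
  have "(r \<otimes> w) \<otimes> (r \<otimes> w) = r \<otimes> (w \<otimes> r) \<otimes> w"
    using r c by (simp add: m_assoc)
  also have "\<dots> = w \<otimes> w"
    using r c by (simp add: inverts m_assoc)
  finally have "(r \<otimes> w) \<otimes> (r \<otimes> w) = w \<otimes> w" .
  then have yy: "y \<otimes> y = conj_by g (w \<otimes> w)"
    using r c g by (simp add: y flip: conj_by_mult)
  have "y \<otimes> y \<in> H"
    using subgroup.m_closed[OF H(1) ty(2) ty(2)] by simp
  moreover have "y \<otimes> y \<in> ?T"
    using subgroup.m_closed[OF fixed_subgroup, of y y] yN ww by (simp add: yy)
  ultimately have "y \<otimes> y = \<one>" using H(3) by blast
  then have "conj_by g (w \<otimes> w) = conj_by g \<one>" using yy g by simp
  then have "w \<otimes> w = \<one>"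
    using g c by (subst (asm) conj_by_eq_iff) auto
  then show False using w(3) by simp
qed

lemma fixed_torus_normal:
  assumes g: "g \<in> carrier G"
  shows "conj_by g ` S \<inter> fixed \<lhd> G\<lparr>carrier := normalizer G (conj_by g ` S) \<inter> fixed\<rparr>"
proof -
  let ?X = "conj_by g ` S"
  let ?N = "normalizer G ?X \<inter> fixed"
  have X: "subgroup ?X G" using g S_subgroup by (rule conj_by_subgroup)
  have Xc: "?X \<subseteq> carrier G" using X by (rule subgroup.subset)
  have N: "subgroup ?N G"
    using subgroup_normalizer[OF Xc] fixed_subgroup by (rule subgroups_Inter_pair)
  have XF: "subgroup (?X \<inter> fixed) G" using X fixed_subgroup by (rule subgroups_Inter_pair)
  have sub: "?X \<inter> fixed \<subseteq> ?N"
    using g S_subset S_normalizer by (auto simp: normalizer_conj_by)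
  interpret N: group "G\<lparr>carrier := ?N\<rparr>" using N by (rule subgroup.subgroup_is_group) (rule is_group)
  show ?thesis
    unfolding N.normal_inv_iff
  proof (intro conjI ballI)
    show "subgroup (?X \<inter> fixed) (G\<lparr>carrier := ?N\<rparr>)"
      using XF N sub subgroup_incl by blast
    fix x s assume x: "x \<in> carrier (G\<lparr>carrier := ?N\<rparr>)" and s: "s \<in> ?X \<inter> fixed"
    have "x \<otimes> s \<otimes> inv x \<in> ?X"
      using x s by (intro normalizer_conjugate_mem[OF Xc]) auto
    moreover have "x \<otimes> s \<otimes> inv x \<in> fixed"
      using x s fixed_subgroup by (auto simp: subgroup.m_closed subgroup.m_inv_closed)
    ultimately show "x \<otimes>\<^bsub>G\<lparr>carrier := ?N\<rparr>\<^esub> s \<otimes>\<^bsub>G\<lparr>carrier := ?N\<rparr>\<^esub> inv\<^bsub>G\<lparr>carrier := ?N\<rparr>\<^esub> x \<in> ?X \<inter> fixed"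
      using x N m_inv_consistent by auto
  qed
qed

text \<open>
  If the normalizer of \<open>S\<close> splits as \<open>S \<rtimes> W\<close> with \<open>\<sigma>\<close> trivial on \<open>W\<close>, then the Lang equation
  allows the twist \<open>h\<close> to be moved into \<open>W\<close>, to an element \<open>u\<close>, by replacing \<open>g\<close> with \<open>s g\<close> for
  some \<open>s\<close> in \<open>S\<close>. The twisted endomorphism then preserves the decomposition \<open>S \<rtimes> W\<close> and acts on
  \<open>W\<close> as conjugation by \<open>u\<close>, so the centralizer of \<open>u\<close> in \<open>W\<close> is a complement.
\<close>

lemma complement:
  assumes g: "g \<in> carrier G" and h: "h \<in> normalizer G S" "\<sigma> g = h \<otimes> g"
    and W: "subgroup W G" "W \<subseteq> normalizer G S" "normalizer G S \<subseteq> S <#> W" "S \<inter> W \<subseteq> {\<one>}"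
    and \<sigma>W: "\<And>b. b \<in> W \<Longrightarrow> \<sigma> b = b"
    and \<sigma>S: "\<And>s. s \<in> S \<Longrightarrow> \<sigma> s \<in> S"
  shows "has_complement G (conj_by g ` S \<inter> fixed) (normalizer G (conj_by g ` S) \<inter> fixed)"
proof -
  interpret S: subgroup S G by (rule S_subgroup)
  interpret W: subgroup W G by (rule W)
  have unique: "t = t' \<and> b = b'"
    if "t \<in> S" "t' \<in> S" "b \<in> W" "b' \<in> W" "t \<otimes> b = t' \<otimes> b'" for t t' b b'
  proof -
    have "inv t' \<otimes> (t \<otimes> b) \<otimes> inv b = inv t' \<otimes> (t' \<otimes> b') \<otimes> inv b"
      by (simp only: that(5))
    then have eq: "inv t' \<otimes> t = b' \<otimes> inv b"
      using that(1-4) by (simp add: m_assoc)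
    moreover have "inv t' \<otimes> t \<in> S" using that(1,2) by simp
    moreover have "b' \<otimes> inv b \<in> W" using that(3,4) by simp
    ultimately have "inv t' \<otimes> t = \<one>" using W(4) by auto
    with eq have "t' \<otimes> (inv t' \<otimes> t) = t'" "b' \<otimes> inv b \<otimes> b = b"
      using that(1-4) by simp_all
    then show "t = t' \<and> b = b'"
      using that(1-4) by (simp add: m_assoc)
  qed
  obtain t u where tu: "t \<in> S" "u \<in> W" "h = t \<otimes> u"
    using h(1) W(3) by (auto simp: set_mult_def)
  obtain s where s: "s \<in> S" "\<sigma> s \<otimes> t = u \<otimes> s \<otimes> inv u"
    using lang[of u t] tu W(2) by blast
  define g' where "g' = s \<otimes> g"
  have g': "g' \<in> carrier G" using g s by (simp add: g'_def)
  have "\<sigma> g' = (\<sigma> s \<otimes> t) \<otimes> u \<otimes> g"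
    using g s(1) tu h by (simp add: g'_def m_assoc)
  also have "\<dots> = (u \<otimes> s \<otimes> inv u) \<otimes> u \<otimes> g"
    by (simp only: s(2))
  also have "\<dots> = u \<otimes> g'"
    using g s(1) tu by (simp add: g'_def m_assoc)
  finally have \<sigma>g': "\<sigma> g' = u \<otimes> g'" .
  have "conj_by s x \<in> S" if "x \<in> S" for x
    using that s by (simp add: conj_by_def)
  moreover have "x \<in> conj_by s ` S" if "x \<in> S" for x
    using that s by (intro image_eqI[of _ _ "conj_by (inv s) x"]) (simp, simp add: conj_by_def)
  ultimately have "conj_by s ` S = S" by blast
  then have tor: "conj_by g ` S = conj_by g' ` S"
    using g s by (force simp: g'_def conj_by_conj_by[symmetric] image_image)
  let ?T = "conj_by g' ` S \<inter> fixed"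
  let ?N = "normalizer G (conj_by g' ` S) \<inter> fixed"
  have fix_iff: "conj_by g' x \<in> fixed \<longleftrightarrow> \<sigma> x = u \<otimes> x \<otimes> inv u" if "x \<in> carrier G" for x
    using conj_by_fixed_iff[OF g' _ \<sigma>g' that] tu by simp
  have N_eq: "normalizer G (conj_by g' ` S) = conj_by g' ` normalizer G S"
    using g' S_subset by (rule normalizer_conj_by)
  have Nsub: "subgroup ?N G"
    using g' S_subset by (intro subgroups_Inter_pair subgroup_normalizer fixed_subgroup) auto
  \<comment> \<open>The elements of \<open>W\<close> whose conjugates are fixed are those commuting with \<open>u\<close>.\<close>
  define H where "H = conj_by g' ` W \<inter> fixed"
  have Hsub: "subgroup H G"
    unfolding H_def by (intro subgroups_Inter_pair conj_by_subgroup g' W fixed_subgroup)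
  have HN: "H \<subseteq> ?N" using W(2) by (auto simp: H_def N_eq)
  have TN: "?T \<subseteq> ?N" using S_normalizer by (auto simp: N_eq)
  have "?T \<inter> H = {\<one>}"
  proof
    show "?T \<inter> H \<subseteq> {\<one>}"
      using W(4) g' by (auto simp: H_def)
    show "{\<one>} \<subseteq> ?T \<inter> H"
      using Hsub conj_by_subgroup[OF g' S_subgroup] fixed_subgroup by (auto simp: subgroup.one_closed)
  qed
  moreover have "?T <#> H = ?N"
  proof
    show "?T <#> H \<subseteq> ?N"
      using TN HN subgroup.m_closed[OF Nsub] by (auto simp: set_mult_def subset_iff)
    show "?N \<subseteq> ?T <#> H"
    proof
      fix x assume x: "x \<in> ?N"
      then obtain y where y: "y \<in> normalizer G S" "x = conj_by g' y" by (auto simp: N_eq)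
      then obtain r b where rb: "r \<in> S" "b \<in> W" "y = r \<otimes> b"
        using W(3) by (auto simp: set_mult_def)
      have "\<sigma> r \<otimes> b = u \<otimes> (r \<otimes> b) \<otimes> inv u"
        using fix_iff[of y] x y rb \<sigma>W by simp
      also have "\<dots> = (u \<otimes> r \<otimes> inv u) \<otimes> (u \<otimes> b \<otimes> inv u)"
        using tu rb by (simp add: m_assoc)
      finally have "\<sigma> r = u \<otimes> r \<otimes> inv u" "b = u \<otimes> b \<otimes> inv u"
        using unique[of "\<sigma> r" "u \<otimes> r \<otimes> inv u" b "u \<otimes> b \<otimes> inv u"] tu rb \<sigma>S W(2)
          normalizer_conjugate_mem[OF S_subset] by auto
      then have "conj_by g' r \<in> ?T" "conj_by g' b \<in> H"
        using rb \<sigma>W by (auto simp: fix_iff H_def)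
      moreover have "x = conj_by g' r \<otimes> conj_by g' b"
        using y rb g' by (simp add: conj_by_mult)
      ultimately show "x \<in> ?T <#> H" by (auto simp: set_mult_def)
    qed
  qed
  moreover have "subgroup H (G\<lparr>carrier := ?N\<rparr>)"
    using Hsub Nsub HN subgroup_incl by blast
  ultimately show ?thesis
    unfolding tor has_complement_def using fixed_torus_normal[OF g'] by auto
qed

end

section \<open>The symplectic group as a matrix group\<close>

lemma symplectic_form_carrier [simp]: "symplectic_form n \<in> carrier_mat (2 * n) (2 * n)"
  by (simp add: symplectic_form_def mult_2 four_block_carrier_mat)

lemma symplectic_form_dim [simp]:
  "dim_row (symplectic_form n) = 2 * n" "dim_col (symplectic_form n) = 2 * n"
  using symplectic_form_carrier by (blast dest: carrier_matD)+

lemma symplectic_form_index: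
  assumes "i < 2 * n" "j < 2 * n"
  shows "symplectic_form n $$ (i, j) =
    (if j = i + n then 1 else if i = j + n then - 1 else 0 :: 'a::field)"
  using assms by (auto simp: symplectic_form_def)

lemma transpose_symplectic_form:
  "transpose_mat (symplectic_form n) = - (symplectic_form n :: 'a::field mat)"
  by (rule eq_matI) (auto simp: symplectic_form_index)

lemma symplectic_form_square:
  "symplectic_form n * symplectic_form n = - (1\<^sub>m (2 * n) :: 'a::field mat)"
proof -
  have "symplectic_form n * symplectic_form n =
      four_block_mat (- 1\<^sub>m n) (0\<^sub>m n n) (0\<^sub>m n n) (- 1\<^sub>m n :: 'a mat)"
    unfolding symplectic_form_def
    by (subst mult_four_block_mat[where ?nr1.0=n and ?nr2.0=n and ?n1.0=n and ?n2.0=n and ?nc1.0=n and ?nc2.0=n])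
      auto
  also have "\<dots> = - 1\<^sub>m (2 * n)"
    by (rule eq_matI) auto
  finally show ?thesis .
qed

lemma mem_GL_iff: "A \<in> carrier (GL m) \<longleftrightarrow> A \<in> carrier_mat m m \<and>
    (\<exists>B\<in>carrier_mat m m. B * A = 1\<^sub>m m \<and> A * B = 1\<^sub>m m)"
  by (auto simp: GL_def units_of_def Units_def ring_mat_def)

lemma mem_GLI:
  assumes "A \<in> carrier_mat m m" "B \<in> carrier_mat m m" "A * B = 1\<^sub>m m"
  shows "A \<in> carrier (GL m)"
  using assms mat_mult_left_right_inverse mem_GL_iff by blast

lemma GL_mult [simp]: "A \<otimes>\<^bsub>GL m\<^esub> B = A * B"
  by (simp add: GL_def units_of_def ring_mat_def)

lemma GL_one [simp]: "\<one>\<^bsub>GL m\<^esub> = 1\<^sub>m m"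
  by (simp add: GL_def units_of_def ring_mat_def)

lemma GL_group: "group (GL m)"
proof -
  interpret ring "ring_mat TYPE('a::field) m ()" by (rule ring_mat)
  show "group (GL m :: 'a mat monoid)" unfolding GL_def by (rule units_group)
qed

lemma Sp_mult [simp]: "A \<otimes>\<^bsub>Sp n\<^esub> B = A * B"
  by (simp add: Sp_def)

lemma Sp_one [simp]: "\<one>\<^bsub>Sp n\<^esub> = 1\<^sub>m (2 * n)"
  by (simp add: Sp_def)

text \<open>
  Preserving a nondegenerate form forces invertibility: \<open>- Q A\<^sup>T Q\<close> is an inverse of \<open>A\<close>.
\<close>

lemma mem_Sp_iff:
  "A \<in> carrier (Sp n) \<longleftrightarrow> A \<in> carrier_mat (2 * n) (2 * n) \<and>
     transpose_mat A * symplectic_form n * A = symplectic_form n"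
proof -
  let ?Q = "symplectic_form n"
  have "A \<in> carrier (GL (2 * n))"
    if A: "A \<in> carrier_mat (2 * n) (2 * n)" and Q: "transpose_mat A * ?Q * A = ?Q"
  proof -
    let ?B = "- (?Q * (transpose_mat A * ?Q))"
    have B: "?B \<in> carrier_mat (2 * n) (2 * n)" using A by auto
    have "?B * A = - (?Q * (transpose_mat A * ?Q) * A)"
      using A by (subst uminus_mult_left_mat) auto
    also have "?Q * (transpose_mat A * ?Q) * A = ?Q * (transpose_mat A * ?Q * A)"
      using A by (intro assoc_mult_mat) auto
    finally have "?B * A = 1\<^sub>m (2 * n)"
      by (simp add: Q symplectic_form_square)
    then show ?thesis
      using A B mat_mult_left_right_inverse[OF B A] mem_GLI by blast
  qed
  then show ?thesis by (auto simp: Sp_def mem_GL_iff)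
qed

lemma Sp_group: "group (Sp n)"
proof -
  interpret GL: group "GL (2 * n) :: 'a::field mat monoid" by (rule GL_group)
  let ?Q = "symplectic_form n :: 'a mat"
  have form: "transpose_mat (A * B) * ?Q * (A * B) = transpose_mat B * (transpose_mat A * ?Q * A) * B"
    if "A \<in> carrier_mat (2 * n) (2 * n)" "B \<in> carrier_mat (2 * n) (2 * n)" for A B :: "'a mat"
    using that by (simp add: transpose_mult[where n = "2 * n"] assoc_mult_mat[of _ "2 * n" "2 * n" _ "2 * n" _ "2 * n"]
        mult_carrier_mat[of _ "2 * n" "2 * n" _ "2 * n"])
  have "subgroup (carrier (Sp n)) (GL (2 * n) :: 'a mat monoid)"
  proof (rule GL.subgroupI)
    show "carrier (Sp n :: 'a mat monoid) \<subseteq> carrier (GL (2 * n))"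
      by (auto simp: Sp_def)
    have "1\<^sub>m (2 * n) \<in> carrier (Sp n :: 'a mat monoid)"
      by (simp add: mem_Sp_iff)
    then show "carrier (Sp n :: 'a mat monoid) \<noteq> {}" by blast
    show "A \<otimes>\<^bsub>GL (2 * n)\<^esub> B \<in> carrier (Sp n)"
      if "A \<in> carrier (Sp n)" "B \<in> carrier (Sp n)" for A B :: "'a mat"
      using that form[of A B] by (auto simp: mem_Sp_iff)
    fix A :: "'a mat" assume A: "A \<in> carrier (Sp n)"
    then have AG: "A \<in> carrier (GL (2 * n))" by (simp add: Sp_def)
    define B where "B = inv\<^bsub>GL (2 * n)\<^esub> A"
    have B: "B \<in> carrier (GL (2 * n))" using AG B_def by simp
    have "A * B = 1\<^sub>m (2 * n)" using GL.r_inv[OF AG] by (simp add: B_def)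
    then show "inv\<^bsub>GL (2 * n)\<^esub> A \<in> carrier (Sp n)"
      using A B form[of A B] unfolding B_def[symmetric] by (auto simp: mem_Sp_iff mem_GL_iff)
  qed
  then have "group ((GL (2 * n))\<lparr>carrier := carrier (Sp n :: 'a mat monoid)\<rparr>)"
    by (rule subgroup.subgroup_is_group) (rule GL_group)
  then show "group (Sp n :: 'a mat monoid)" by (simp add: Sp_def)
qed

section \<open>The diagonal torus\<close>

text \<open>
  The torus is handled through diagonal entries, as functions on positions; only the values
  below \<open>2 n\<close> matter.
\<close>

definition symplectic_weights :: "nat \<Rightarrow> (nat \<Rightarrow> 'a::field) \<Rightarrow> bool" where
  "symplectic_weights n d \<longleftrightarrow> (\<forall>i<n. d i * d (i + n) = 1)"

lemma symplectic_weights_nonzero: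
  assumes "symplectic_weights n d" "i < 2 * n"
  shows "d i \<noteq> 0"
proof (cases "i < n")
  case True
  then show ?thesis using assms by (auto simp: symplectic_weights_def)
next
  case False
  then have "d (i - n) * d i = 1"
    using assms by (auto simp: symplectic_weights_def dest: spec[of _ "i - n"])
  then show ?thesis by auto
qed

lemma symplectic_weights_mult:
  "symplectic_weights n d \<Longrightarrow> symplectic_weights n e \<Longrightarrow> symplectic_weights n (\<lambda>i. d i * e i)"
  unfolding symplectic_weights_def
  by (metis mult.assoc mult.left_commute mult_1_right)

lemma mat_diag_eq_iff: "mat_diag m d = mat_diag m e \<longleftrightarrow> (\<forall>i<m. d i = e i)"
  by (auto simp: mat_diag_def mat_eq_iff)

lemma mat_diag_index: "i < m \<Longrightarrow> j < m \<Longrightarrow> mat_diag m d $$ (i, j) = (if i = j then d i else 0)"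
  by (auto simp: mat_diag_def)

lemma mat_diag_dims [simp]: "dim_row (mat_diag m d) = m" "dim_col (mat_diag m d) = m"
  by (simp_all add: mat_diag_def)

lemma transpose_mat_diag: "transpose_mat (mat_diag m d) = mat_diag m d"
  by (rule eq_matI) (auto simp: mat_diag_index)

lemma mat_diag_Sp:
  "mat_diag (2 * n) d \<in> carrier (Sp n) \<longleftrightarrow> symplectic_weights n (d :: nat \<Rightarrow> 'a::field)"
proof -
  have idx: "(mat_diag (2 * n) d * symplectic_form n * mat_diag (2 * n) d) $$ (i, j)
      = d i * symplectic_form n $$ (i, j) * d j" if "i < 2 * n" "j < 2 * n" for i j
    using that by (simp add: mat_diag_mult_left[OF symplectic_form_carrier] mat_diag_mult_right[of _ "2 * n"])
  have "mat_diag (2 * n) d \<in> carrier (Sp n) \<longleftrightarrow>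
      (\<forall>i<2 * n. \<forall>j<2 * n. d i * symplectic_form n $$ (i, j) * d j = symplectic_form n $$ (i, j))"
    unfolding mem_Sp_iff transpose_mat_diag mat_eq_iff by (auto simp: idx simp del: index_mult_mat(1))
  also have "\<dots> \<longleftrightarrow> symplectic_weights n d"
  proof
    assume *: "\<forall>i<2 * n. \<forall>j<2 * n. d i * symplectic_form n $$ (i, j) * d j = symplectic_form n $$ (i, j)"
    show "symplectic_weights n d"
      unfolding symplectic_weights_def
    proof (intro allI impI)
      fix i assume "i < n"
      then show "d i * d (i + n) = 1"
        using *[rule_format, of i "i + n"] by (simp add: symplectic_form_index)
    qed
  next
    assume "symplectic_weights n d"
    then show "\<forall>i<2 * n. \<forall>j<2 * n. d i * symplectic_form n $$ (i, j) * d j = symplectic_form n $$ (i, j)"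
      by (auto simp: symplectic_form_index symplectic_weights_def mult.commute)
  qed
  finally show ?thesis .
qed

lemma diagonal_matD: "diagonal_mat A \<Longrightarrow> A \<in> carrier_mat m m \<Longrightarrow> A = mat_diag m (\<lambda>i. A $$ (i, i))"
  by (rule eq_matI) (auto simp: diagonal_mat_def mat_diag_index)

lemma diagonal_mat_diag: "diagonal_mat (mat_diag m d)"
  by (auto simp: diagonal_mat_def mat_diag_index)

lemma mat_diag_GL:
  assumes "\<And>i. i < m \<Longrightarrow> d i * e i = 1"
  shows "mat_diag m d \<in> carrier (GL m)" "inv\<^bsub>GL m\<^esub> mat_diag m d = mat_diag m e"
proof -
  interpret GL: group "GL m :: 'a mat monoid" by (rule GL_group)
  have 1: "mat_diag m (\<lambda>i. d i * e i) = 1\<^sub>m m" "mat_diag m (\<lambda>i. e i * d i) = 1\<^sub>m m"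
    unfolding mat_diag_one[symmetric] mat_diag_eq_iff using assms by (simp_all add: mult.commute)
  show c: "mat_diag m d \<in> carrier (GL m)"
    by (rule mem_GLI[of _ _ "mat_diag m e"]) (simp_all add: 1)
  have "mat_diag m e \<in> carrier (GL m)"
    by (rule mem_GLI[of _ _ "mat_diag m d"]) (simp_all add: 1)
  then show "inv\<^bsub>GL m\<^esub> mat_diag m d = mat_diag m e"
    using c by (intro GL.inv_equality) (simp_all add: 1)
qed

lemma four_block_mat_diag:
  "four_block_mat (mat_diag n d) (0\<^sub>m n n) (0\<^sub>m n n) (mat_diag n e) =
     mat_diag (2 * n) (\<lambda>i. if i < n then d i else e (i - n))"
  by (rule eq_matI) (auto simp: mat_diag_index)

lemma T0_eq:
  "T0 n = {mat_diag (2 * n) d | d. symplectic_weights n (d :: nat \<Rightarrow> 'a::field)}" (is "?L = ?R")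
proof (intro equalityI subsetI)
  interpret GL: group "GL n :: 'a mat monoid" by (rule GL_group)
  fix A :: "'a mat" assume "A \<in> ?L"
  then obtain D where A: "A \<in> carrier (Sp n)" and D: "D \<in> carrier (GL n)" "diagonal_mat D"
    and A_eq: "A = four_block_mat D (0\<^sub>m n n) (0\<^sub>m n n) (inv\<^bsub>GL n\<^esub> D)"
    by (auto simp: T0_def)
  have Dc: "D \<in> carrier_mat n n" using D(1) by (simp add: mem_GL_iff)
  define d where "d i = D $$ (i, i)" for i
  have D_eq: "D = mat_diag n d"
    using diagonal_matD[OF D(2) Dc] by (simp add: d_def[abs_def])
  obtain B where B: "B \<in> carrier_mat n n" "D * B = 1\<^sub>m n"
    using D(1) by (auto simp: mem_GL_iff)
  have "d i * B $$ (i, i) = 1" if "i < n" for i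
  proof -
    have "(D * B) $$ (i, i) = 1" using B that by simp
    then show ?thesis using that B by (simp add: D_eq mat_diag_mult_left[OF B(1)])
  qed
  then have "inv\<^bsub>GL n\<^esub> D = mat_diag n (\<lambda>i. B $$ (i, i))"
    unfolding D_eq by (rule mat_diag_GL(2))
  then have A_diag: "A = mat_diag (2 * n) (\<lambda>i. if i < n then d i else B $$ (i - n, i - n))"
    using A_eq D_eq four_block_mat_diag[of n d "\<lambda>i. B $$ (i, i)"] by simp
  then show "A \<in> ?R" using A unfolding A_diag mat_diag_Sp by blast
next
  fix A :: "'a mat" assume "A \<in> ?R"
  then obtain d where d: "symplectic_weights n d" "A = mat_diag (2 * n) d" by blast
  have *: "d i * d (i + n) = 1" if "i < n" for i
    using d that by (simp add: symplectic_weights_def)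
  have "A = four_block_mat (mat_diag n d) (0\<^sub>m n n) (0\<^sub>m n n) (mat_diag n (\<lambda>i. d (i + n)))"
    unfolding four_block_mat_diag d(2) mat_diag_eq_iff by simp
  moreover have "A \<in> carrier (Sp n)" using d mat_diag_Sp by blast
  ultimately show "A \<in> ?L"
    using mat_diag_GL[OF *] diagonal_mat_diag unfolding T0_def by (auto intro!: exI[of _ "mat_diag n d"])
qed

lemma mem_T0_iff: "A \<in> T0 n \<longleftrightarrow> A \<in> carrier (Sp n) \<and> diagonal_mat A"
proof
  assume "A \<in> T0 n"
  then show "A \<in> carrier (Sp n) \<and> diagonal_mat A"
    using mat_diag_Sp diagonal_mat_diag by (fastforce simp: T0_eq)
next
  assume A: "A \<in> carrier (Sp n) \<and> diagonal_mat A"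
  then have "A \<in> carrier_mat (2 * n) (2 * n)" by (simp add: mem_Sp_iff)
  then have eq: "A = mat_diag (2 * n) (\<lambda>i. A $$ (i, i))" using A diagonal_matD by blast
  then have "symplectic_weights n (\<lambda>i. A $$ (i, i))" using A mat_diag_Sp by metis
  then show "A \<in> T0 n" using eq unfolding T0_eq by blast
qed

lemma T0_subgroup: "subgroup (T0 n) (Sp n :: 'a::field mat monoid)"
proof -
  interpret Sp: group "Sp n :: 'a mat monoid" by (rule Sp_group)
  show ?thesis
  proof (rule Sp.subgroupI)
    show "T0 n \<subseteq> carrier (Sp n :: 'a mat monoid)" by (auto simp: mem_T0_iff)
    have "1\<^sub>m (2 * n) \<in> (T0 n :: 'a mat set)"
      unfolding T0_eq mem_Collect_eq
      by (rule exI[of _ "\<lambda>_. 1"]) (simp add: symplectic_weights_def)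
    then show "T0 n \<noteq> ({} :: 'a mat set)" by blast
    fix A :: "'a mat" assume "A \<in> T0 n"
    then obtain d where d: "symplectic_weights n d" "A = mat_diag (2 * n) d" by (auto simp: T0_eq)
    let ?B = "mat_diag (2 * n) (\<lambda>i. inverse (d i))"
    have B: "symplectic_weights n (\<lambda>i. inverse (d i))"
      using d(1) by (auto simp: symplectic_weights_def simp flip: inverse_mult_distrib)
    have "inverse (d i) * d i = 1" if "i < 2 * n" for i
      using symplectic_weights_nonzero[OF d(1) that] by simp
    then have "?B * A = 1\<^sub>m (2 * n)"
      unfolding d(2) mat_diag_diag mat_diag_one[symmetric] mat_diag_eq_iff by simp
    then have "inv\<^bsub>Sp n\<^esub> A = ?B"
      using B d by (intro Sp.inv_equality) (auto simp: mat_diag_Sp)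
    then show "inv\<^bsub>Sp n\<^esub> A \<in> T0 n" using B by (auto simp: T0_eq)
  next
    fix A B :: "'a mat" assume "A \<in> T0 n" "B \<in> T0 n"
    then show "A \<otimes>\<^bsub>Sp n\<^esub> B \<in> T0 n"
      using symplectic_weights_mult by (fastforce simp: T0_eq)
  qed
qed

lemma T0_commute: "A \<in> T0 n \<Longrightarrow> B \<in> T0 n \<Longrightarrow> A * B = B * (A :: 'a::field mat)"
  by (auto simp: T0_eq mult.commute)

section \<open>The Frobenius endomorphism\<close>

lemma frobenius_hom:
  assumes "prime CHAR('a::field)" and q: "q = CHAR('a) ^ a"
  shows "frobenius q \<in> hom (Sp n) (Sp n :: 'a mat monoid)"
    and "frobenius q (symplectic_form n) = (symplectic_form n :: 'a mat)"
proof -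
  have q0: "q > 0" using assms prime_gt_0_nat by simp
  have add: "(x + y) ^ q = x ^ q + y ^ q" for x y :: 'a
    using assms by (intro freshmans_dream') auto
  interpret h: comm_ring_hom "\<lambda>x :: 'a. x ^ q"
    by standard (use q0 in \<open>auto simp: add power_mult_distrib\<close>)
  have mult: "frobenius q (A * B) = frobenius q A * frobenius q B"
    if "A \<in> carrier_mat (2 * n) (2 * n)" "B \<in> carrier_mat (2 * n) (2 * n)" for A B :: "'a mat"
    unfolding frobenius_def using that by (rule h.mat_hom_mult)
  have neg: "(- 1 :: 'a) ^ q = - 1" using h.hom_uminus[of 1] by simp
  show Q: "frobenius q (symplectic_form n) = (symplectic_form n :: 'a mat)"
    unfolding frobenius_def using q0 by (intro eq_matI) (auto simp: symplectic_form_index neg)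
  have "frobenius q A \<in> carrier (Sp n)" if "A \<in> carrier (Sp n)" for A :: "'a mat"
  proof -
    have A: "A \<in> carrier_mat (2 * n) (2 * n)"
      and AQ: "transpose_mat A * symplectic_form n * A = symplectic_form n"
      using that by (auto simp: mem_Sp_iff)
    have "transpose_mat (frobenius q A) = frobenius q (transpose_mat A)"
      by (simp add: frobenius_def map_mat_transpose)
    then have "transpose_mat (frobenius q A) * symplectic_form n * frobenius q A
        = frobenius q (transpose_mat A * symplectic_form n * A)"
      using A by (simp add: mult Q)
    then show ?thesis using A by (simp add: mem_Sp_iff AQ Q) (simp add: frobenius_def)
  qed
  then show "frobenius q \<in> hom (Sp n) (Sp n :: 'a mat monoid)"
    by (auto simp: hom_def mult mem_Sp_iff)
qed


section \<open>Twisted Lang equations in the diagonal torus\<close>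

lemma symplectic_weights_power:
  "symplectic_weights n d \<Longrightarrow> symplectic_weights n (\<lambda>i. d i ^ k)"
  by (simp add: symplectic_weights_def flip: power_mult_distrib)

lemma symplectic_weights_prod:
  assumes "\<And>k. k \<in> K \<Longrightarrow> symplectic_weights n (d k)"
  shows "symplectic_weights n (\<lambda>i. \<Prod>k\<in>K. d k i)"
  using assms by (simp add: symplectic_weights_def flip: prod.distrib)

text \<open>
  The Lang equation for the torus, written in diagonal entries. Because \<open>f\<close> has some finite order
  \<open>N\<close>, the \<open>N\<close>-th power of the twisted Frobenius map is the untwisted \<open>q^N\<close>-th power map, for which
  the equation decouples into \<open>x i ^ (q^N - 1) = inverse (c i)\<close> and is solved by roots. The product
  \<open>d\<close> of the twisted conjugates of \<open>x\<close> solves the original equation by telescoping, uniformly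
  for all cycle types of \<open>f\<close>.
\<close>

lemma lang_weights:
  fixes c :: "nat \<Rightarrow> 'a::alg_closed_field"
  assumes f: "f permutes {..<2 * n}"
    and stable: "\<And>d :: nat \<Rightarrow> 'a. symplectic_weights n d \<Longrightarrow> symplectic_weights n (d \<circ> f)"
    and c: "symplectic_weights n c" and q: "q \<ge> 2"
  shows "\<exists>d. symplectic_weights n d \<and> (\<forall>i<2 * n. d (f i) = d i ^ q * c i)"
proof -
  have "permutation f" using f permutation_permutes by blast
  then obtain N where N: "f ^^ N = id" "N > 0" by (rule permutation_is_nilpotent)
  define E where "E = q ^ N - 1"
  have "q ^ N \<ge> 2" using N q by (metis One_nat_def Suc_leI le_trans power_increasing power_one_right one_le_numeral)
  then have E: "E > 0" "q ^ N = Suc E" by (simp_all add: E_def)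
  have "\<forall>i. \<exists>y. y ^ E = inverse (c i)" using nth_root_exists[OF E(1)] by blast
  then obtain y where y: "\<And>i. y i ^ E = inverse (c i)" by metis
  \<comment> \<open>Roots are chosen freely on the first half only, to keep \<open>x\<close> in the torus.\<close>
  define x where "x i = (if i < n then y i else inverse (y (i - n)))" for i
  have xc: "x i \<noteq> 0 \<and> x i ^ E * c i = 1" if "i < 2 * n" for i
  proof (cases "i < n")
    case True
    have "c i \<noteq> 0" using c that by (rule symplectic_weights_nonzero)
    then show ?thesis using True y[of i] E(1) by (auto simp: x_def power_0_left)
  next
    case False
    have i: "i - n < 2 * n" "i - n < n" using that False by auto
    have c0: "c (i - n) \<noteq> 0" using c i(1) by (rule symplectic_weights_nonzero)
    have "c (i - n) * c i = 1"
      using c i False by (auto simp: symplectic_weights_def dest: spec[of _ "i - n"])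
    then show ?thesis using False y[of "i - n"] c0 E(1) by (auto simp: x_def power_inverse power_0_left)
  qed
  have x: "symplectic_weights n x"
    unfolding symplectic_weights_def
  proof (intro allI impI)
    fix i assume "i < n"
    then show "x i * x (i + n) = 1" using xc[of i] by (simp add: x_def)
  qed
  have xf: "symplectic_weights n (\<lambda>i. x ((f ^^ k) i))" for k
  proof (induction k)
    case (Suc k)
    then show ?case using stable[OF Suc] by (simp add: funpow_Suc_right comp_def del: funpow.simps)
  qed (use x in simp)
  define d where "d i = (\<Prod>k<N. x ((f ^^ k) i) ^ q ^ (N - Suc k))" for i
  have "symplectic_weights n d"
    unfolding d_def[abs_def] by (intro symplectic_weights_prod symplectic_weights_power xf)
  moreover have "d (f i) = d i ^ q * c i" if i: "i < 2 * n" for i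
  proof -
    define g where "g k = x ((f ^^ k) i) ^ q ^ (N - k)" for k
    have "d (f i) = (\<Prod>k<N. g (Suc k))"
      by (simp add: d_def g_def funpow_swap1)
    moreover have "d i ^ q = (\<Prod>k<N. g k)"
    proof -
      have "(x ((f ^^ k) i) ^ q ^ (N - Suc k)) ^ q = g k" if "k < N" for k
      proof -
        have "N - k = Suc (N - Suc k)" using that by simp
        then show ?thesis by (simp add: g_def mult.commute flip: power_mult)
      qed
      then show ?thesis by (simp add: d_def prod_power_distrib)
    qed
    moreover have "g 0 * (\<Prod>k<N. g (Suc k)) = (\<Prod>k<N. g k) * g N"
      by (metis prod.lessThan_Suc prod.lessThan_Suc_shift)
    moreover have "g 0 = x i ^ E * x i" "g N = x i"
      using N by (simp_all add: g_def E(2) mult.commute)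
    ultimately have "x i ^ E * x i * d (f i) = d i ^ q * x i" by simp
    then have "x i ^ E * d (f i) = d i ^ q"
      using xc[OF i] by (simp add: mult.commute mult.left_commute)
    then have "(x i ^ E * c i) * d (f i) = d i ^ q * c i" by (simp add: ac_simps)
    then show ?thesis using xc[OF i] by simp
  qed
  ultimately show ?thesis by blast
qed

section \<open>The normalizer of the diagonal torus\<close>

text \<open>
  In characteristic other than two a square root of \<open>-1\<close> is a witness, in characteristic two a
  primitive third root of unity.
\<close>

lemma exists_non_involution:
  "\<exists>c :: 'a::alg_closed_field. c \<noteq> 0 \<and> c * c \<noteq> 1"
proof (rule ccontr)
  assume "\<not> ?thesis"
  then have inv: "c * c = 1" if "c \<noteq> 0" for c :: 'a using that by blast
  obtain y :: 'a where "y ^ 2 = - 1" using nth_root_exists[of 2 "- 1 :: 'a"] by auto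
  then have "(1 :: 'a) = - 1" using inv[of y] by (cases "y = 0") (auto simp: power2_eq_square)
  then have two: "1 + 1 = (0 :: 'a)" by (metis add.right_inverse)
  obtain x :: 'a where "(\<Sum>k\<le>2. 1 * x ^ k) = 0" using alg_closed[of 2 "\<lambda>_. 1"] by auto
  then have x: "1 + x + x * x = 0" by (simp add: numeral_2_eq_2)
  then have "x \<noteq> 0" by auto
  then have "(1 + 1) + x = 0" using inv[of x] x by (simp add: ac_simps)
  then show False using two \<open>x \<noteq> 0\<close> by simp
qed

lemma symplectic_weights_separate:
  assumes "j < 2 * n" "j' < 2 * n" "j \<noteq> j'"
  shows "\<exists>d :: nat \<Rightarrow> 'a::alg_closed_field. symplectic_weights n d \<and> d j \<noteq> d j'"
proof -
  obtain c :: 'a where c: "c \<noteq> 0" "c * c \<noteq> 1" using exists_non_involution by blast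
  then have "c \<noteq> inverse c" "c \<noteq> 1" "inverse c \<noteq> 1" by (auto simp: field_simps)
  define k where "k = (if j < n then j else j - n)"
  define d where "d i = (if i = k then c else if i = k + n then inverse c else 1)" for i
  have k: "k < n" using assms by (auto simp: k_def)
  have "symplectic_weights n d"
    using k c by (auto simp: symplectic_weights_def d_def)
  moreover have "d j \<noteq> d j'"
    using assms \<open>c \<noteq> inverse c\<close> \<open>c \<noteq> 1\<close> \<open>inverse c \<noteq> 1\<close> by (auto simp: d_def k_def)
  ultimately show ?thesis by blast
qed

definition monomial :: "nat \<Rightarrow> 'a::zero mat \<Rightarrow> (nat \<Rightarrow> nat) \<Rightarrow> bool" where
  "monomial m M f \<longleftrightarrow> M \<in> carrier_mat m m \<and> f permutes {..<m} \<and>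
     (\<forall>i<m. \<forall>j<m. M $$ (i, j) \<noteq> 0 \<longleftrightarrow> j = f i)"

lemma monomial_mult_diag:
  assumes "monomial m M f"
  shows "M * mat_diag m d = mat_diag m (d \<circ> f) * (M :: 'a::field mat)"
proof -
  have "M \<in> carrier_mat m m" using assms by (simp add: monomial_def)
  then show ?thesis
    using assms by (auto simp: mat_diag_mult_left mat_diag_mult_right monomial_def mat_eq_iff)
qed

text \<open>
  If \<open>M D = E M\<close> with diagonal \<open>D\<close> and \<open>E\<close>, then the entries of \<open>D\<close> at the columns of the nonzero
  entries of one row all agree. As the torus separates any two positions, each row has a single
  nonzero entry; invertibility makes the positions distinct.
\<close>

lemma normalizer_T0_monomial:
  fixes M :: "'a::alg_closed_field mat"
  assumes M: "M \<in> normalizer (Sp n) (T0 n)"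
  shows "\<exists>f. monomial (2 * n) M f"
proof -
  interpret Sp: group "Sp n :: 'a mat monoid" by (rule Sp_group)
  have sub: "T0 n \<subseteq> carrier (Sp n :: 'a mat monoid)"
    by (rule subgroup.subset[OF T0_subgroup])
  have MS: "M \<in> carrier (Sp n)" using M sub by (simp add: Sp.mem_normalizer_iff)
  have Mc: "M \<in> carrier_mat (2 * n) (2 * n)" using MS by (simp add: mem_Sp_iff)
  define B where "B = inv\<^bsub>Sp n\<^esub> M"
  have Bc: "B \<in> carrier_mat (2 * n) (2 * n)"
    using Sp.inv_closed[OF MS] by (simp add: B_def mem_Sp_iff)
  have MB: "M * B = 1\<^sub>m (2 * n)" and BM: "B * M = 1\<^sub>m (2 * n)"
    using Sp.r_inv[OF MS] Sp.l_inv[OF MS] by (simp_all add: B_def)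
  have row_le: "M $$ (i, j) = 0 \<or> M $$ (i, j') = 0"
    if i: "i < 2 * n" and j: "j < 2 * n" "j' < 2 * n" "j \<noteq> j'" for i j j'
  proof -
    obtain d :: "nat \<Rightarrow> 'a" where d: "symplectic_weights n d" "d j \<noteq> d j'"
      using symplectic_weights_separate[OF j] by blast
    have "M * mat_diag (2 * n) d * B \<in> T0 n"
      using Sp.normalizer_conjugate_mem[OF sub M, of "mat_diag (2 * n) d"] d(1)
      by (auto simp: T0_eq B_def)
    then obtain e where e: "M * mat_diag (2 * n) d * B = mat_diag (2 * n) e"
      by (auto simp: T0_eq)
    have "M * mat_diag (2 * n) d = M * mat_diag (2 * n) d * B * M"
      using Mc Bc BM by (simp add: assoc_mult_mat[of _ "2 * n" "2 * n" _ "2 * n" _ "2 * n"]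
        mult_carrier_mat[of _ "2 * n" "2 * n" _ "2 * n"])
    then have *: "M * mat_diag (2 * n) d = mat_diag (2 * n) e * M" by (simp add: e)
    have "M $$ (i, l) * d l = e i * M $$ (i, l)" if "l < 2 * n" for l
      using arg_cong[OF *, of "\<lambda>A. A $$ (i, l)"] i that Mc
      by (simp add: mat_diag_mult_left mat_diag_mult_right)
    from this[OF j(1)] this[OF j(2)] show ?thesis using d(2) by auto
  qed
  have sum: "(M * B) $$ (i, k) = (\<Sum>l<2 * n. M $$ (i, l) * B $$ (l, k))"
    if "i < 2 * n" "k < 2 * n" for i k
    using that Mc Bc by (simp add: scalar_prod_def atLeast0LessThan)
  have row_ge: "\<exists>j<2 * n. M $$ (i, j) \<noteq> 0" if i: "i < 2 * n" for i
  proof (rule ccontr)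
    assume "\<not> ?thesis"
    then have "(M * B) $$ (i, i) = 0" unfolding sum[OF i i] by (intro sum.neutral) auto
    then show False using MB i by simp
  qed
  define f where "f i = (if i < 2 * n then SOME j. j < 2 * n \<and> M $$ (i, j) \<noteq> 0 else i)" for i
  have f: "f i < 2 * n" "M $$ (i, f i) \<noteq> 0" if "i < 2 * n" for i
    using someI_ex[OF row_ge[OF that]] that by (auto simp: f_def)
  have f_iff: "M $$ (i, j) \<noteq> 0 \<longleftrightarrow> j = f i" if "i < 2 * n" "j < 2 * n" for i j
    using f[OF that(1)] row_le[OF that(1) that(2), of "f i"] by auto
  have entry: "(M * B) $$ (i, k) = M $$ (i, f i) * B $$ (f i, k)"
    if "i < 2 * n" "k < 2 * n" for i k
  proof -
    have "(M * B) $$ (i, k) = (\<Sum>l\<in>{f i}. M $$ (i, l) * B $$ (l, k))"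
      unfolding sum[OF that] using f[OF that(1)] f_iff[OF that(1)]
      by (intro sum.mono_neutral_right) auto
    then show ?thesis by simp
  qed
  have "inj_on f {..<2 * n}"
  proof (rule inj_onI)
    fix i k assume ik: "i \<in> {..<2 * n}" "k \<in> {..<2 * n}" "f i = f k"
    have "M $$ (k, f k) * B $$ (f k, k) = 1"
      using entry[of k k] ik MB by simp
    then have "M $$ (i, f i) * B $$ (f i, k) \<noteq> 0"
      using f(2)[of i] ik by auto
    then have "(1\<^sub>m (2 * n) :: 'a mat) $$ (i, k) \<noteq> 0"
      using entry[of i k] ik MB by simp
    then show "i = k" using ik by (auto split: if_splits)
  qed
  then have "bij_betw f {..<2 * n} {..<2 * n}"
    using f by (intro bij_betw_imageI endo_inj_surj) auto
  then have "f permutes {..<2 * n}"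
    by (rule bij_imp_permutes) (simp add: f_def)
  then show ?thesis using Mc f_iff by (auto simp: monomial_def)
qed

lemma monomial_conj_T0:
  fixes M :: "'a::alg_closed_field mat"
  assumes M: "M \<in> carrier (Sp n)" and f: "monomial (2 * n) M f"
  shows "M * mat_diag (2 * n) d * inv\<^bsub>Sp n\<^esub> M = mat_diag (2 * n) (d \<circ> f)"
proof -
  interpret Sp: group "Sp n :: 'a mat monoid" by (rule Sp_group)
  have Mc: "M \<in> carrier_mat (2 * n) (2 * n)" "inv\<^bsub>Sp n\<^esub> M \<in> carrier_mat (2 * n) (2 * n)"
    using M Sp.inv_closed[OF M] by (simp_all add: mem_Sp_iff)
  have "mat_diag (2 * n) (d \<circ> f) * M * inv\<^bsub>Sp n\<^esub> M = mat_diag (2 * n) (d \<circ> f) * (M * inv\<^bsub>Sp n\<^esub> M)"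
    using Mc by (intro assoc_mult_mat) auto
  then show ?thesis
    using Sp.r_inv[OF M] by (simp add: monomial_mult_diag[OF f] right_mult_one_mat[of _ "2 * n" "2 * n"])
qed

lemma T0_lang:
  fixes M C :: "'a::alg_closed_field mat"
  assumes M: "M \<in> normalizer (Sp n) (T0 n)" and C: "C \<in> T0 n" and q: "q \<ge> 2"
  shows "\<exists>D\<in>T0 n. frobenius q D * C = M * D * inv\<^bsub>Sp n\<^esub> M"
proof -
  interpret Sp: group "Sp n :: 'a mat monoid" by (rule Sp_group)
  have sub: "T0 n \<subseteq> carrier (Sp n :: 'a mat monoid)"
    by (rule subgroup.subset[OF T0_subgroup])
  have MS: "M \<in> carrier (Sp n)" using M sub by (simp add: Sp.mem_normalizer_iff)
  obtain f where f: "monomial (2 * n) M f" using normalizer_T0_monomial[OF M] by blast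
  have stable: "symplectic_weights n (d \<circ> f)" if "symplectic_weights n d" for d :: "nat \<Rightarrow> 'a"
  proof -
    have "M * mat_diag (2 * n) d * inv\<^bsub>Sp n\<^esub> M \<in> T0 n"
      using Sp.normalizer_conjugate_mem[OF sub M, of "mat_diag (2 * n) d"] that by (auto simp: T0_eq)
    then show ?thesis
      unfolding monomial_conj_T0[OF MS f] mem_T0_iff mat_diag_Sp by blast
  qed
  obtain c where c: "symplectic_weights n c" "C = mat_diag (2 * n) c" using C by (auto simp: T0_eq)
  obtain d where d: "symplectic_weights n d" "\<And>i. i < 2 * n \<Longrightarrow> d (f i) = d i ^ q * c i"
    using lang_weights[OF _ stable c(1) q] f unfolding monomial_def by blast
  have "frobenius q (mat_diag (2 * n) d) = mat_diag (2 * n) (\<lambda>i. d i ^ q)"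
    using q by (auto simp: frobenius_def mat_eq_iff mat_diag_index)
  then have "frobenius q (mat_diag (2 * n) d) * C = mat_diag (2 * n) (d \<circ> f)"
    using d by (simp add: c mat_diag_eq_iff)
  then show ?thesis
    using d(1) monomial_conj_T0[OF MS f] by (intro bexI[of _ "mat_diag (2 * n) d"]) (auto simp: T0_eq)
qed

lemma frobenius_T0:
  assumes "A \<in> T0 n" "q > 0"
  shows "frobenius q A \<in> T0 (n :: nat)"
proof -
  obtain d where d: "symplectic_weights n d" "A = mat_diag (2 * n) d" using assms by (auto simp: T0_eq)
  have "frobenius q A = mat_diag (2 * n) (\<lambda>i. d i ^ q)"
    using assms(2) by (auto simp: d frobenius_def mat_eq_iff mat_diag_index)
  then show ?thesis using symplectic_weights_power[OF d(1)] by (auto simp: T0_eq)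
qed

text \<open>
  The torus separates any two positions, so a matrix commuting with it is diagonal.
\<close>

lemma T0_centralizer:
  fixes A :: "'a::alg_closed_field mat"
  assumes A: "A \<in> carrier (Sp n)" and comm: "\<And>D. D \<in> T0 n \<Longrightarrow> A * D = D * A"
  shows "A \<in> T0 n"
  unfolding mem_T0_iff diagonal_mat_def
proof (intro conjI allI impI)
  have Ac: "A \<in> carrier_mat (2 * n) (2 * n)" using A by (simp add: mem_Sp_iff)
  fix i j assume "i < dim_row A" "j < dim_col A" and ne: "i \<noteq> j"
  then have ij: "i < 2 * n" "j < 2 * n" using Ac by auto
  obtain d :: "nat \<Rightarrow> 'a" where d: "symplectic_weights n d" "d i \<noteq> d j"
    using symplectic_weights_separate[OF ij ne] by blast
  have "A * mat_diag (2 * n) d = mat_diag (2 * n) d * A"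
    using d(1) by (intro comm) (auto simp: T0_eq)
  then have "A $$ (i, j) * d j = d i * A $$ (i, j)"
    using arg_cong[of _ _ "\<lambda>B. B $$ (i, j)"] ij Ac
    by (fastforce simp: mat_diag_mult_left mat_diag_mult_right)
  then show "A $$ (i, j) = 0" using d(2) by auto
qed (rule A)

section \<open>Permutation matrices and characteristic two\<close>

definition perm_mat :: "nat \<Rightarrow> (nat \<Rightarrow> nat) \<Rightarrow> 'a::field mat" where
  "perm_mat m f = mat m m (\<lambda>(i, j). if j = f i then 1 else 0)"

lemma perm_mat_carrier [simp]: "perm_mat m f \<in> carrier_mat m m"
  by (simp add: perm_mat_def)

lemma perm_mat_dim [simp]: "dim_row (perm_mat m f) = m" "dim_col (perm_mat m f) = m"
  by (simp_all add: perm_mat_def)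

lemma perm_mat_index: "i < m \<Longrightarrow> j < m \<Longrightarrow> perm_mat m f $$ (i, j) = (if j = f i then 1 else 0)"
  by (simp add: perm_mat_def)

lemma perm_mat_id: "perm_mat m id = 1\<^sub>m m"
  by (rule eq_matI) (auto simp: perm_mat_index)

lemma mult_perm_mat_index:
  assumes "f permutes {..<m}" "A \<in> carrier_mat l m" "i < l" "k < m"
  shows "(A * perm_mat m f) $$ (i, f k) = A $$ (i, k)"
proof -
  have fk: "f k < m" using assms permutes_in_image[of f "{..<m}" k] by simp
  have "(A * perm_mat m f) $$ (i, f k) = (\<Sum>l<m. A $$ (i, l) * (if f k = f l then 1 else 0))"
    using assms fk by (simp add: scalar_prod_def atLeast0LessThan perm_mat_index)
  also have "\<dots> = (\<Sum>l<m. if l = k then A $$ (i, l) else 0)"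
    using permutes_inj[OF assms(1)] by (intro sum.cong) (auto dest: injD)
  finally show ?thesis using assms by simp
qed

lemma transpose_perm_mat_mult_index:
  assumes "f permutes {..<m}" "A \<in> carrier_mat m l" "i < l" "k < m"
  shows "(transpose_mat (perm_mat m f) * A) $$ (f k, i) = (A :: 'a::field mat) $$ (k, i)"
proof -
  have fk: "f k < m" using assms permutes_in_image[of f "{..<m}" k] by simp
  have "(transpose_mat (perm_mat m f) * A) $$ (f k, i)
      = transpose_mat (transpose_mat (perm_mat m f) * A) $$ (i, f k)"
    using assms fk by simp
  also have "\<dots> = (transpose_mat A * perm_mat m f) $$ (i, f k)"
    using assms(2) by (subst transpose_mult[of _ m m _ l]) auto
  also have "\<dots> = A $$ (k, i)"
    using assms by (subst mult_perm_mat_index[of _ _ _ l]) auto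
  finally show ?thesis .
qed

lemma perm_mat_mult:
  assumes "f permutes {..<m}" "g permutes {..<m}"
  shows "perm_mat m f * perm_mat m g = perm_mat m (g \<circ> f)"
proof (rule eq_matI)
  fix i j assume ij: "i < dim_row (perm_mat m (g \<circ> f))" "j < dim_col (perm_mat m (g \<circ> f))"
  define k where "k = inv_into UNIV g j"
  have j: "j = g k" using permutes_inverses(1)[OF assms(2)] by (simp add: k_def)
  have k: "k < m" using ij permutes_in_image[OF permutes_inv[OF assms(2)], of j] by (simp add: k_def)
  show "(perm_mat m f * perm_mat m g) $$ (i, j) = perm_mat m (g \<circ> f) $$ (i, j)"
    using ij k permutes_inj[OF assms(2)] unfolding j
    by (subst mult_perm_mat_index[OF assms(2), of _ m]) (auto simp: perm_mat_index dest: injD)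
qed auto

lemma monomial_decomp:
  assumes "monomial m M f"
  shows "M = mat_diag m (\<lambda>i. M $$ (i, f i)) * perm_mat m f"
proof -
  have "M \<in> carrier_mat m m" using assms by (simp add: monomial_def)
  then show ?thesis using assms
    by (auto simp: mat_diag_mult_left[of _ _ m] mat_eq_iff perm_mat_index monomial_def)
qed

text \<open>
  The value of the form on two columns of a monomial matrix has a single term. For the columns
  \<open>f i\<close> and \<open>f (i + n)\<close> it is the product of the nonzero entries in rows \<open>i\<close> and \<open>i + n\<close>, and
  invariance of the form makes it a nonzero entry of the form, that is \<open>1\<close> or \<open>-1\<close>.
  The sign is the obstruction to splitting, and it disappears in characteristic two.
\<close>

lemma monomial_weights_char_2:
  fixes M :: "'a::field mat"
  assumes M: "M \<in> carrier (Sp n)" and f: "monomial (2 * n) M f" and char: "1 + 1 = (0 :: 'a)"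
  shows "symplectic_weights n (\<lambda>i. M $$ (i, f i))"
  unfolding symplectic_weights_def
proof (intro allI impI)
  fix i assume i: "i < n"
  define d where "d i = M $$ (i, f i)" for i
  let ?Q = "symplectic_form n :: 'a mat" and ?P = "perm_mat (2 * n) f :: 'a mat"
    and ?D = "mat_diag (2 * n) d"
  have perm: "f permutes {..<2 * n}" and Mc: "M \<in> carrier_mat (2 * n) (2 * n)"
    using f by (simp_all add: monomial_def)
  have fc: "f k < 2 * n" if "k < 2 * n" for k
    using that permutes_in_image[OF perm, of k] by simp
  have M_eq: "M = ?D * ?P" using monomial_decomp[OF f] by (simp add: d_def[abs_def])
  have "?Q = transpose_mat M * ?Q * M" using M by (simp add: mem_Sp_iff)
  also have "\<dots> = transpose_mat ?P * (?D * ?Q * ?D * ?P)"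
    unfolding M_eq
    by (simp add: transpose_mult[of _ "2 * n" "2 * n" _ "2 * n"] transpose_mat_diag
        assoc_mult_mat[of _ "2 * n" "2 * n" _ "2 * n" _ "2 * n"]
        mult_carrier_mat[of _ "2 * n" "2 * n" _ "2 * n"])
  finally have "?Q $$ (f i, f (i + n)) = (transpose_mat ?P * (?D * ?Q * ?D * ?P)) $$ (f i, f (i + n))"
    by (rule arg_cong)
  also have "\<dots> = (?D * ?Q * ?D * ?P) $$ (i, f (i + n))"
    using i fc[of "i + n"] by (intro transpose_perm_mat_mult_index[OF perm, of _ "2 * n"]) auto
  also have "\<dots> = (?D * ?Q * ?D) $$ (i, i + n)"
    using i by (intro mult_perm_mat_index[OF perm, of _ "2 * n"]) auto
  also have "\<dots> = d i * d (i + n)"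
    using i by (simp add: mat_diag_mult_left[OF symplectic_form_carrier]
        mat_diag_mult_right[of _ "2 * n"] symplectic_form_index)
  finally have eq: "?Q $$ (f i, f (i + n)) = d i * d (i + n)" .
  moreover have "d i * d (i + n) \<noteq> 0"
    using f i fc by (auto simp: monomial_def d_def)
  ultimately have "d i * d (i + n) = 1 \<or> d i * d (i + n) = - 1"
    using symplectic_form_index[OF fc[of i] fc[of "i + n"], where 'a = 'a] i
    by (auto split: if_splits)
  moreover have "- 1 = (1 :: 'a)" using char by (simp add: eq_neg_iff_add_eq_0 flip: add_eq_0_iff2)
  ultimately have "d i * d (i + n) = 1" by (elim disjE) (simp_all only:)
  then show "M $$ (i, f i) * M $$ (i + n, f (i + n)) = 1" by (simp add: d_def)
qed

text \<open>
  In characteristic two this is the Weyl group, realized inside the normalizer of the torus.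
\<close>

definition perm_normalizer :: "nat \<Rightarrow> 'a::field mat set" where
  "perm_normalizer n = {perm_mat (2 * n) f | f. f permutes {..<2 * n} \<and>
     perm_mat (2 * n) f \<in> normalizer (Sp n) (T0 n :: 'a mat set)}"

lemma perm_normalizer_subgroup: "subgroup (perm_normalizer n) (Sp n :: 'a::field mat monoid)"
proof -
  interpret Sp: group "Sp n :: 'a mat monoid" by (rule Sp_group)
  let ?N = "normalizer (Sp n) (T0 n :: 'a mat set)"
  have N: "subgroup ?N (Sp n)"
    by (rule Sp.subgroup_normalizer[OF subgroup.subset[OF T0_subgroup]])
  show ?thesis
  proof (rule Sp.subgroupI)
    show "perm_normalizer n \<subseteq> carrier (Sp n :: 'a mat monoid)"
      using subgroup.subset[OF N] by (auto simp: perm_normalizer_def)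
    have "perm_mat (2 * n) id \<in> (perm_normalizer n :: 'a mat set)"
      using subgroup.one_closed[OF N] permutes_id unfolding perm_normalizer_def
      by (auto simp: perm_mat_id intro!: exI[of _ id])
    then show "perm_normalizer n \<noteq> ({} :: 'a mat set)" by blast
    fix A :: "'a mat" assume A: "A \<in> perm_normalizer n"
    then obtain f where f: "f permutes {..<2 * n}" "A = perm_mat (2 * n) f" "A \<in> ?N"
      by (auto simp: perm_normalizer_def)
    have Ac: "A \<in> carrier (Sp n)" using f(3) subgroup.mem_carrier[OF N] by blast
    have "A * perm_mat (2 * n) (inv_into UNIV f) = 1\<^sub>m (2 * n)"
      using f(1) by (simp add: f(2) perm_mat_mult permutes_inv permutes_inv_o perm_mat_id)
    then have "inv\<^bsub>Sp n\<^esub> A * A * perm_mat (2 * n) (inv_into UNIV f) = inv\<^bsub>Sp n\<^esub> A"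
      using Ac Sp.inv_closed[OF Ac] by (simp add: mem_Sp_iff assoc_mult_mat[of _ "2 * n" "2 * n" _ "2 * n" _ "2 * n"]
          right_mult_one_mat[of _ "2 * n" "2 * n"])
    then have inv_eq: "inv\<^bsub>Sp n\<^esub> A = perm_mat (2 * n) (inv_into UNIV f)"
      using Sp.l_inv[OF Ac] by simp
    have "inv\<^bsub>Sp n\<^esub> A \<in> ?N" using f(3) subgroup.m_inv_closed[OF N] by blast
    then show "inv\<^bsub>Sp n\<^esub> A \<in> perm_normalizer n"
      using inv_eq permutes_inv[OF f(1)] by (auto simp: perm_normalizer_def)
  next
    fix A B :: "'a mat" assume A: "A \<in> perm_normalizer n" and B: "B \<in> perm_normalizer n"
    obtain f where f: "f permutes {..<2 * n}" "A = perm_mat (2 * n) f" "A \<in> ?N"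
      using A by (auto simp: perm_normalizer_def)
    obtain g where g: "g permutes {..<2 * n}" "B = perm_mat (2 * n) g" "B \<in> ?N"
      using B by (auto simp: perm_normalizer_def)
    have "A * B = perm_mat (2 * n) (g \<circ> f)" using f g by (simp add: perm_mat_mult)
    moreover have "A * B \<in> ?N" using subgroup.m_closed[OF N f(3) g(3)] by simp
    ultimately show "A \<otimes>\<^bsub>Sp n\<^esub> B \<in> perm_normalizer n"
      using permutes_compose[OF f(1) g(1)] by (auto simp: perm_normalizer_def)
  qed
qed

lemma T0_Int_perm_normalizer: "T0 n \<inter> perm_normalizer n \<subseteq> {1\<^sub>m (2 * n) :: 'a::field mat}"
proof
  fix A :: "'a mat" assume A: "A \<in> T0 n \<inter> perm_normalizer n"
  then obtain f where f: "f permutes {..<2 * n}" "A = perm_mat (2 * n) f"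
    by (auto simp: perm_normalizer_def)
  have "f i = i" if "i < 2 * n" for i
  proof (rule ccontr)
    assume "f i \<noteq> i"
    moreover have "f i < 2 * n" using that permutes_in_image[OF f(1), of i] by simp
    ultimately have "A $$ (i, f i) = 0"
      using A that by (auto simp: mem_T0_iff diagonal_mat_def f(2))
    then show False using that \<open>f i < 2 * n\<close> by (simp add: f(2) perm_mat_index)
  qed
  then have "f = id" using f(1) by (auto simp: permutes_def fun_eq_iff)
  then show "A \<in> {1\<^sub>m (2 * n)}" by (simp add: f(2) perm_mat_id)
qed

lemma normalizer_decomp_char_2:
  assumes char: "1 + 1 = (0 :: 'a::alg_closed_field)"
  shows "normalizer (Sp n) (T0 n) \<subseteq> T0 n <#>\<^bsub>Sp n\<^esub> (perm_normalizer n :: 'a mat set)"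
proof
  interpret Sp: group "Sp n :: 'a mat monoid" by (rule Sp_group)
  let ?N = "normalizer (Sp n) (T0 n :: 'a mat set)"
  have sub: "T0 n \<subseteq> carrier (Sp n :: 'a mat monoid)" by (rule subgroup.subset[OF T0_subgroup])
  have N: "subgroup ?N (Sp n)" by (rule Sp.subgroup_normalizer[OF sub])
  fix M :: "'a mat" assume M: "M \<in> ?N"
  have MS: "M \<in> carrier (Sp n)" using subgroup.mem_carrier[OF N M] .
  obtain f where f: "monomial (2 * n) M f" using normalizer_T0_monomial[OF M] by blast
  let ?D = "mat_diag (2 * n) (\<lambda>i. M $$ (i, f i))" and ?P = "perm_mat (2 * n) f :: 'a mat"
  have D: "?D \<in> T0 n" using monomial_weights_char_2[OF MS f char] by (auto simp: T0_eq)
  have DS: "?D \<in> carrier (Sp n)" using D sub by blast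
  have DN: "?D \<in> ?N"
    using D DS sub T0_subgroup[of n, where 'a = 'a]
    by (intro Sp.normalizerI) (auto simp: subgroup.m_closed subgroup.m_inv_closed simp del: Sp_mult)
  have "?P = inv\<^bsub>Sp n\<^esub> ?D * ?D * ?P" using Sp.l_inv[OF DS] by simp
  also have "\<dots> = inv\<^bsub>Sp n\<^esub> ?D * (?D * ?P)"
    using Sp.inv_closed[OF DS] by (intro assoc_mult_mat[of _ "2 * n" "2 * n" _ "2 * n" _ "2 * n"]) (auto simp: mem_Sp_iff)
  also have "?D * ?P = M" using monomial_decomp[OF f] by simp
  finally have "?P \<in> ?N"
    using subgroup.m_closed[OF N subgroup.m_inv_closed[OF N DN] M] by simp
  then have "?P \<in> perm_normalizer n"
    using f by (auto simp: perm_normalizer_def monomial_def)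
  then show "M \<in> T0 n <#>\<^bsub>Sp n\<^esub> perm_normalizer n"
    using D monomial_decomp[OF f] by (auto simp: set_mult_def)
qed

section \<open>Inverting the torus by the symplectic form\<close>

lemma symplectic_form_Sp: "symplectic_form n \<in> carrier (Sp n)"
  by (simp add: mem_Sp_iff transpose_symplectic_form symplectic_form_square
      uminus_mult_left_mat)

text \<open>
  The symplectic form, regarded as a group element, represents the central element \<open>-1\<close> of the
  Weyl group: for symmetric \<open>D\<close> the defining relation of the group reads \<open>D Q D = Q\<close>.
\<close>

lemma symplectic_form_inverts_T0:
  fixes D :: "'a::field mat"
  assumes D: "D \<in> T0 n"
  shows "symplectic_form n * D = inv\<^bsub>Sp n\<^esub> D * symplectic_form n"
proof -
  interpret Sp: group "Sp n :: 'a mat monoid" by (rule Sp_group)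
  have DS: "D \<in> carrier (Sp n)" using D by (simp add: mem_T0_iff)
  have Q: "symplectic_form n \<in> carrier (Sp n :: 'a mat monoid)" by (rule symplectic_form_Sp)
  obtain d where d: "D = mat_diag (2 * n) d" using D by (auto simp: T0_eq)
  have "D * symplectic_form n * D = symplectic_form n"
    using DS unfolding mem_Sp_iff d transpose_mat_diag by blast
  then have "D \<otimes>\<^bsub>Sp n\<^esub> (symplectic_form n \<otimes>\<^bsub>Sp n\<^esub> D) = symplectic_form n"
    using Sp.m_assoc[OF DS Q DS] by simp
  then have "inv\<^bsub>Sp n\<^esub> D \<otimes>\<^bsub>Sp n\<^esub> symplectic_form n = symplectic_form n \<otimes>\<^bsub>Sp n\<^esub> D"
    using Sp.mult_inv_cancel_left(2)[OF DS Sp.m_closed[OF Q DS]] by metis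
  then show ?thesis by simp
qed

lemma lang_torus_Sp:
  assumes "prime CHAR('a::alg_closed_field)" "q = CHAR('a) ^ a" "a \<ge> 1"
  shows "lang_torus (Sp n) (frobenius q) (T0 n :: 'a mat set)"
proof -
  interpret Sp: group "Sp n :: 'a mat monoid" by (rule Sp_group)
  have "q \<ge> 2"
    using assms prime_ge_2_nat[OF assms(1)] by (metis One_nat_def le_trans self_le_power not_less_eq_eq less_eq_Suc_le prime_gt_0_nat)
  then show ?thesis
    using frobenius_hom(1)[OF assms(1,2)] T0_subgroup T0_commute T0_lang
    by (intro lang_torus.intro lang_torus_axioms.intro Sp_group) auto
qed

section \<open>Splitting of the torus normalizer\<close>

theorem mainTheorem4:
  fixes p q a n k :: nat
    and ns :: "nat list"
    and Tbar :: "'p::prime_card mod_ring alg_closure mat set"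
  assumes "p = CARD('p)"
    and "1 \<le> a" and "q = p ^ a"
    and "1 \<le> n"
    and "maximal_torus n Tbar"
    and "frobenius q ` Tbar = Tbar"
    and "torus_has_type n q Tbar k ns"
  shows "has_complement (Sp n) (Tbar \<inter> Sp_fixed n q) (normalizer (Sp n) Tbar \<inter> Sp_fixed n q)
    \<longleftrightarrow> p = 2"
proof -
  have p: "CHAR('p mod_ring alg_closure) = p" using assms(1) by simp
  have prime: "prime p" using assms(1) prime_card by blast
  interpret lang_torus "Sp n" "frobenius q" "T0 n :: 'p mod_ring alg_closure mat set"
    by (rule lang_torus_Sp[where a = a]) (use p prime assms in auto)
  obtain g where g: "g \<in> carrier (Sp n)" "Tbar = inv\<^bsub>Sp n\<^esub> g <#\<^bsub>Sp n\<^esub> T0 n #>\<^bsub>Sp n\<^esub> g"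
      "frobenius q g \<otimes>\<^bsub>Sp n\<^esub> inv\<^bsub>Sp n\<^esub> g \<in> normalizer (Sp n) (T0 n)"
    using assms(7) unfolding torus_has_type_def by blast
  have Tbar: "Tbar = conj_by g ` T0 n" using g(2) by (simp add: conj_by_image_eq_coset)
  define h where "h = frobenius q g \<otimes>\<^bsub>Sp n\<^esub> inv\<^bsub>Sp n\<^esub> g"
  have h: "h \<in> normalizer (Sp n) (T0 n)" using g(3) by (simp add: h_def)
  have gh: "frobenius q g = h \<otimes>\<^bsub>Sp n\<^esub> g"
    using g(1) by (simp add: h_def m_assoc del: Sp_mult Sp_one)
  have fixed: "fixed = Sp_fixed n q" by (simp add: fixed_def Sp_fixed_def)
  have q0: "q > 0" using assms(3) prime prime_gt_0_nat by simp
  show ?thesis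
  proof
    assume "has_complement (Sp n) (Tbar \<inter> Sp_fixed n q) (normalizer (Sp n) Tbar \<inter> Sp_fixed n q)"
    moreover have "\<not> has_complement (Sp n) (Tbar \<inter> Sp_fixed n q) (normalizer (Sp n) Tbar \<inter> Sp_fixed n q)"
      if "p \<noteq> 2"
      unfolding Tbar fixed[symmetric]
    proof (rule no_complement[OF g(1) h gh symplectic_form_Sp])
      show "frobenius q (symplectic_form n) = (symplectic_form n :: 'p mod_ring alg_closure mat)"
        by (rule frobenius_hom(2)[where a = a]) (use p prime assms in auto)
      have "of_nat 2 \<noteq> (0 :: 'p mod_ring alg_closure)"
        unfolding of_nat_eq_0_iff_char_dvd p using that prime
        by (metis primes_dvd_imp_eq two_is_prime_nat)
      then have "(- 1 :: 'p mod_ring alg_closure) \<noteq> 1"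
        by (metis add.right_inverse of_nat_numeral one_add_one)
      then have "(- (1\<^sub>m (2 * n)) :: 'p mod_ring alg_closure mat) $$ (0, 0) \<noteq> 1\<^sub>m (2 * n) $$ (0, 0)"
        using assms(4) by simp
      then show "symplectic_form n \<otimes>\<^bsub>Sp n\<^esub> symplectic_form n \<noteq> \<one>\<^bsub>Sp n :: 'p mod_ring alg_closure mat monoid\<^esub>"
        by (metis Sp_mult Sp_one symplectic_form_square)
    qed (auto intro: T0_centralizer symplectic_form_inverts_T0)
    ultimately show "p = 2" by blast
  next
    assume "p = 2"
    then have "of_nat 2 = (0 :: 'p mod_ring alg_closure)" using of_nat_CHAR p by metis
    then have char: "1 + 1 = (0 :: 'p mod_ring alg_closure)" by simp
    show "has_complement (Sp n) (Tbar \<inter> Sp_fixed n q) (normalizer (Sp n) Tbar \<inter> Sp_fixed n q)"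
      unfolding Tbar fixed[symmetric]
    proof (rule complement[OF g(1) h gh perm_normalizer_subgroup])
      show "perm_normalizer n \<subseteq> normalizer (Sp n) (T0 n)" by (auto simp: perm_normalizer_def)
      show "frobenius q b = b" if "b \<in> perm_normalizer n" for b :: "'p mod_ring alg_closure mat"
        using that q0 by (auto simp: perm_normalizer_def frobenius_def mat_eq_iff perm_mat_index)
    qed (use normalizer_decomp_char_2[OF char] T0_Int_perm_normalizer frobenius_T0 q0 in auto)
  qed
qed

end
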